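(* Let $M$ be a real symmetric $n\times n$ matrix with ordered eigenvalues $\lambda_1\ge\lambda_2\ge\cdots\ge\lambda_n$, and let $\mathcal{O}_M=\mathrm{conv}\{gMg^T : g\in O(n)\}$. Then $$\mathcal{O}_M=\Bigl\{A\in \mathrm{Sym}_2\mathbb{R}^n \;:\; \mathrm{Tr}(A)=\mathrm{Tr}(M)\ \text{ and }\ \Bigl(\sum_{i=1}^k\lambda_i\Bigr)\mathrm{Id}_{\binom nk}-\mathcal{L}_k(A)\succeq 0\ \text{ for } k=1,\dots,n-1\Bigr\}.$$
   Context: $\mathrm{Sym}_2\mathbb{R}^n$ denotes the space of real symmetric $n\times n$ matrices, $O(n)$ the orthogonal group, $\mathrm{conv}$ the convex hull, and $\succeq 0$ positive semidefiniteness. $\mathcal{O}_M$ is called the symmetric Schur-Horn orbitope of $M$. For an $n\times n$ matrix $B$, the $k$-th additive compound matrix $\mathcal{L}_k(B)$ is the $\binom nk\times\binom nk$ matrix representing, in the standard basis $\{e_{i_1}\wedge\cdots\wedge e_{i_k}\}_{i_1<\cdots<i_k}$ of $\wedge_k\mathbb{R}^n$, the linear map $$v_{1}\wedge\cdots\wedge v_{k}\mapsto\sum_{j=1}^k v_{1}\wedge\cdots\wedge v_{j-1}\wedge(Bv_{j})\wedge v_{j+1}\wedge\cdots\wedge v_{k}.$$ *)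

theory Defs
  imports
    "HOL-Analysis.Analysis"
    "HOL-Library.Sublist"
    "HOL-Combinatorics.Combinatorics"
    "Jordan_Normal_Form.Determinant"
begin

text \<open>The symmetric matrices live in the euclidean space \<^typ>\<open>real^'n^'n\<close>. A compound matrix has the
  varying size \<^term>\<open>CARD('n) choose k\<close>, so it is a matrix of type \<^typ>\<open>real Matrix.mat\<close>.\<close>

no_notation Matrix.vec_index (infixl "$" 100)
notation Matrix.vec_index (infixl "$v" 100)
no_notation Matrix.scalar_prod (infix "\<bullet>" 70)

definition orbitope :: "real^'n^'n \<Rightarrow> (real^'n^'n) set" where
  "orbitope M = convex hull {g ** M ** transpose g | g. orthogonal_matrix g}"

definition charpoly :: "real^'n^'n \<Rightarrow> real poly" where
  "charpoly M = Determinants.det (Finite_Cartesian_Product.mat [:0, 1:] - (\<chi> i j. [:M $ i $ j:]))"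

text \<open>\<^term>\<open>lam 1\<close>, ..., \<^term>\<open>lam CARD('n)\<close> are the eigenvalues with multiplicity; the
  values of \<^term>\<open>lam\<close> at other indices are irrelevant.\<close>

definition ordered_eigenvalues :: "real^'n^'n \<Rightarrow> (nat \<Rightarrow> real) \<Rightarrow> bool" where
  "ordered_eigenvalues M lam \<longleftrightarrow>
     charpoly M = (\<Prod>i=1..CARD('n). [:- lam i, 1:]) \<and>
     (\<forall>i j. 1 \<le> i \<and> i \<le> j \<and> j \<le> CARD('n) \<longrightarrow> lam j \<le> lam i)"

definition pos_semidef :: "real Matrix.mat \<Rightarrow> bool" where
  "pos_semidef Q \<longleftrightarrow> transpose_mat Q = Q \<and>
     (\<forall>v \<in> carrier_vec (dim_row Q). 0 \<le> scalar_prod v (Q *\<^sub>v v))"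

text \<open>The strictly increasing \<open>k\<close>-tuples of indices, in lexicographic order.\<close>

definition increasing_tuples :: "nat \<Rightarrow> 'n::{finite,linorder} list list" where
  "increasing_tuples k = filter (\<lambda>I. length I = k) (subseqs (sorted_list_of_set UNIV))"

text \<open>The element $v_1 \wedge \dots \wedge v_k$ of the exterior power, given by its coordinates in
  the standard basis $e_{i_1} \wedge \dots \wedge e_{i_k}$, $i_1 < \dots < i_k$, that is, by the
  \<open>k\<close>-minors of the matrix with columns $v_1, \dots, v_k$.\<close>

definition wedge :: "(real^'n::{finite,linorder}) list \<Rightarrow> real Matrix.vec" where
  "wedge vs = Matrix.vec (CARD('n) choose length vs)
     (\<lambda>i. Determinant.det (Matrix.mat (length vs) (length vs)
        (\<lambda>(r, c). (vs ! c) $ (increasing_tuples (length vs) ! i ! r))))"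

definition basis_tuple :: "nat \<Rightarrow> nat \<Rightarrow> (real^'n::{finite,linorder}) list" where
  "basis_tuple k j = map (\<lambda>a. axis a 1) (increasing_tuples k ! j)"

text \<open>Column \<open>j\<close> consists of the coordinates of the image of the \<open>j\<close>-th standard basis element.
  That this matrix represents the linear map on all of the exterior power is
  \<open>additive_compound_wedge\<close> below.\<close>

definition additive_compound :: "nat \<Rightarrow> real^'n::{finite,linorder}^'n::{finite,linorder} \<Rightarrow> real Matrix.mat" where
  "additive_compound k B = Matrix.mat (CARD('n) choose k) (CARD('n) choose k)
     (\<lambda>(i, j). \<Sum>c<k. wedge ((basis_tuple k j)[c := B *v (basis_tuple k j ! c)]) $v i)"

lemma filter_Nil_subseqs: "filter (\<lambda>I. I = []) (subseqs xs) = [[]]"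
  by (induction xs) (simp_all add: Let_def filter_map o_def)

lemma length_filter_subseqs:
  "length (filter (\<lambda>I. length I = k) (subseqs xs)) = length xs choose k"
proof (induction xs arbitrary: k)
  case Nil
  then show ?case by (cases k) auto
next
  case (Cons x xs)
  have "length (filter (\<lambda>I. length I = k) (map ((#) x) (subseqs xs)))
     = (case k of 0 \<Rightarrow> 0 | Suc k' \<Rightarrow> length xs choose k')"
    by (cases k) (simp_all add: filter_map o_def Cons.IH)
  then show ?case
    by (cases k) (simp_all add: Let_def Cons.IH filter_Nil_subseqs)
qed

lemma length_increasing_tuples:
  "length (increasing_tuples k :: 'n::{finite,linorder} list list) = CARD('n) choose k"
  by (simp add: increasing_tuples_def length_filter_subseqs)

lemma set_increasing_tuples:
  "set (increasing_tuples k :: 'n::{finite,linorder} list list)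
     = {I. length I = k \<and> sorted_wrt (<) I}"
proof -
  have "subseq I (sorted_list_of_set (UNIV :: 'n set)) \<longleftrightarrow> sorted_wrt (<) I" for I :: "'n list"
  proof
    assume "subseq I (sorted_list_of_set (UNIV :: 'n set))"
    then obtain N where "I = nths (sorted_list_of_set (UNIV :: 'n set)) N"
      by (auto simp: subseq_conv_nths)
    then show "sorted_wrt (<) I"
      by (simp add: strict_sorted_iff sorted_nths)
  next
    assume "sorted_wrt (<) I"
    then show "subseq I (sorted_list_of_set (UNIV :: 'n set))"
      by (intro sorted_subset_imp_subseq) (auto simp: strict_sorted_iff)
  qed
  then show ?thesis
    by (auto simp: increasing_tuples_def)
qed

lemma distinct_increasing_tuples: "distinct (increasing_tuples k :: 'n::{finite,linorder} list list)"
proof -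
  have "distinct (subseqs (sorted_list_of_set (UNIV :: 'n set)))"
    using distinct_set_subseqs[of "sorted_list_of_set (UNIV :: 'n set)"] by (simp add: distinct_map)
  then show ?thesis
    by (simp add: increasing_tuples_def)
qed

lemma increasing_tuples_nth:
  assumes "i < CARD('n) choose k"
  shows "length (increasing_tuples k ! i :: 'n::{finite,linorder} list) = k"
    and "sorted_wrt (<) (increasing_tuples k ! i :: 'n::{finite,linorder} list)"
proof -
  have "increasing_tuples k ! i \<in> set (increasing_tuples k :: 'n list list)"
    using assms by (intro nth_mem) (simp add: length_increasing_tuples)
  then show "length (increasing_tuples k ! i :: 'n list) = k"
    and "sorted_wrt (<) (increasing_tuples k ! i :: 'n list)"
    by (auto simp: set_increasing_tuples)
qed

lemma length_basis_tuple:
  "j < CARD('n) choose k \<Longrightarrow> length (basis_tuple k j :: (real^'n::{finite,linorder}) list) = k"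
  by (simp add: basis_tuple_def increasing_tuples_nth)

lemma wedge_basis_tuple:
  assumes j: "j < CARD('n) choose k"
  shows "wedge (basis_tuple k j :: (real^'n::{finite,linorder}) list) = unit_vec (CARD('n) choose k) j"
proof (rule eq_vecI)
  fix i assume "i < dim_vec (unit_vec (CARD('n) choose k) j :: real Matrix.vec)"
  then have i: "i < CARD('n) choose k" by simp
  let ?T = "increasing_tuples k :: 'n list list"
  let ?A = "Matrix.mat k k (\<lambda>(r, c). if ?T ! i ! r = ?T ! j ! c then 1 else 0) :: real Matrix.mat"
  have eq: "wedge (basis_tuple k j :: (real^'n::{finite,linorder}) list) $v i = Determinant.det ?A"
    unfolding wedge_def length_basis_tuple[OF j]
    using i j by (auto simp: basis_tuple_def increasing_tuples_nth axis_def
        intro!: arg_cong[where f = Determinant.det] eq_matI)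
  show "wedge (basis_tuple k j :: (real^'n::{finite,linorder}) list) $v i = unit_vec (CARD('n) choose k) j $v i"
  proof (cases "i = j")
    case True
    have "distinct (?T ! j)"
      using increasing_tuples_nth(2)[OF j] by (simp add: strict_sorted_iff)
    then have "?A = 1\<^sub>m k"
      using True j by (auto intro!: eq_matI simp: nth_eq_iff_index_eq increasing_tuples_nth)
    with eq True i show ?thesis by simp
  next
    case False
    have d: "distinct (?T ! i)" "distinct (?T ! j)"
      using increasing_tuples_nth(2)[OF i] increasing_tuples_nth(2)[OF j]
      by (auto simp: strict_sorted_iff)
    have ne: "?T ! i \<noteq> ?T ! j"
      using False i j distinct_increasing_tuples[of k, where ?'n = 'n]
      by (simp add: nth_eq_iff_index_eq length_increasing_tuples)
    have "set (?T ! i) \<noteq> set (?T ! j)"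
      using strict_sorted_equal[OF increasing_tuples_nth(2)[OF i] increasing_tuples_nth(2)[OF j]] ne
      by auto
    moreover have "card (set (?T ! i)) = card (set (?T ! j))"
      using d i j by (simp add: distinct_card increasing_tuples_nth)
    ultimately have "\<not> set (?T ! i) \<subseteq> set (?T ! j)"
      by (metis card_subset_eq finite_set)
    then obtain r where r: "r < k" "?T ! i ! r \<notin> set (?T ! j)"
      using i by (auto simp: in_set_conv_nth increasing_tuples_nth subset_iff)
    have "(\<Prod>m = 0..<k. ?A $$ (m, p m)) = 0" if "p permutes {0..<k}" for p
    proof -
      have pr: "p r < k" using permutes_in_image[OF that, of r] r by simp
      then have "?T ! j ! p r \<in> set (?T ! j)" using j by (simp add: increasing_tuples_nth)
      then have "?A $$ (r, p r) = 0" using r pr by auto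
      then show ?thesis using r by (intro prod_zero) auto
    qed
    then have "(\<Sum>p | p permutes {0..<k}. signof p * (\<Prod>m = 0..<k. ?A $$ (m, p m))) = 0"
      by (intro sum.neutral) (simp del: prod_zero_iff)
    then have "Determinant.det ?A = 0"
      using Determinant.det_def'[of ?A k] by (simp only: mat_carrier)
    with eq False i j show ?thesis by simp
  qed
qed (simp add: wedge_def length_basis_tuple[OF j])

definition alternating :: "nat \<Rightarrow> ((real^'n) list \<Rightarrow> real) \<Rightarrow> bool" where
  "alternating k F \<longleftrightarrow>
     (\<forall>vs c. length vs = k \<and> c < k \<longrightarrow> linear (\<lambda>x. F (vs[c := x]))) \<and>
     (\<forall>vs a b. length vs = k \<and> a < b \<and> b < k \<and> vs ! a = vs ! b \<longrightarrow> F vs = 0)"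

lemma alternating_linear:
  "alternating k F \<Longrightarrow> length vs = k \<Longrightarrow> c < k \<Longrightarrow> linear (\<lambda>x. F (vs[c := x]))"
  by (auto simp: alternating_def)

lemma alternating_eq_0:
  assumes "alternating k F" "length vs = k" "a \<noteq> b" "a < k" "b < k" "vs ! a = vs ! b"
  shows "F vs = 0"
  using assms by (cases a b rule: linorder_cases) (metis alternating_def)+

lemma alternating_swap:
  assumes F: "alternating k F" and vs: "length vs = k" and ab: "a \<noteq> b" "a < k" "b < k"
  shows "F (vs[a := y, b := x]) = - F (vs[a := x, b := y])"
proof -
  have la: "F (ws[a := u + v]) = F (ws[a := u]) + F (ws[a := v])" if "length ws = k" for ws u v
    using linear_add[OF alternating_linear[OF F that ab(2)]] .
  have lb: "F (ws[b := u + v]) = F (ws[b := u]) + F (ws[b := v])" if "length ws = k" for ws u v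
    using linear_add[OF alternating_linear[OF F that ab(3)]] .
  have z: "F (vs[a := u, b := u]) = 0" for u
    using vs ab by (intro alternating_eq_0[OF F _ ab]) auto
  have comm: "vs[b := u, a := v] = vs[a := v, b := u]" for u v
    using ab by (intro list_update_swap) auto
  have "0 = F (vs[a := x + y, b := x + y])" by (simp add: z)
  also have "\<dots> = F (vs[a := x + y, b := x]) + F (vs[a := x + y, b := y])"
    using vs by (simp add: lb)
  also have "\<dots> = F (vs[b := x, a := x + y]) + F (vs[b := y, a := x + y])"
    by (simp only: comm)
  also have "\<dots> = F (vs[b := x, a := x]) + F (vs[b := x, a := y]) +
      (F (vs[b := y, a := x]) + F (vs[b := y, a := y]))"
    using vs by (simp add: la)
  also have "\<dots> = F (vs[a := y, b := x]) + F (vs[a := x, b := y])"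
    by (simp add: comm z)
  finally show ?thesis by simp
qed

lemma alternating_permute:
  assumes F: "alternating k F" and p: "p permutes {..<k}"
    and vs: "length vs = k" "F vs = 0"
  shows "F (permute_list p vs) = 0"
proof -
  have "\<forall>vs. length vs = k \<and> F vs = 0 \<longrightarrow> F (permute_list p vs) = 0"
    using p finite_lessThan
  proof (induction rule: permutes_induct)
    case id
    show ?case by simp
  next
    case (swap a b p)
    show ?case
    proof (intro allI impI, elim conjE)
      fix vs assume vs: "length vs = k" "F vs = 0"
      have "permute_list (Transposition.transpose a b) vs = vs[a := vs ! b, b := vs ! a]"
        using vs swap
        by (intro nth_equalityI)
          (auto simp: permute_list_def nth_list_update Transposition.transpose_def)
      also have "F \<dots> = - F (vs[a := vs ! a, b := vs ! b])"
        using swap vs by (intro alternating_swap[OF F]) auto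
      finally have "F (permute_list (Transposition.transpose a b) vs) = 0"
        using vs by simp
      then show "F (permute_list (Transposition.transpose a b \<circ> p) vs) = 0"
        using swap vs by (simp add: permute_list_compose)
    qed
  qed
  with vs show ?thesis by blast
qed

lemma alternating_zero:
  fixes F :: "(real^'n::{finite,linorder}) list \<Rightarrow> real"
  assumes F: "alternating k F"
    and basis: "\<And>j. j < CARD('n) choose k \<Longrightarrow> F (basis_tuple k j) = 0"
    and vs: "length vs = k"
  shows "F vs = 0"
proof -
  have ax: "F (map (\<lambda>a. axis a 1) I) = 0" if I: "length I = k" for I :: "'n list"
  proof (cases "distinct I")
    case False
    then obtain a b where "a \<noteq> b" "a < k" "b < k" "I ! a = I ! b"
      using I by (auto simp: distinct_conv_nth)
    then show ?thesis
      using I by (intro alternating_eq_0[OF F, of _ a b]) auto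
  next
    case True
    then have "sort I \<in> set (increasing_tuples k)"
      using I by (simp add: set_increasing_tuples strict_sorted_iff)
    then obtain j where j: "j < CARD('n) choose k" "sort I = increasing_tuples k ! j"
      by (auto simp: in_set_conv_nth length_increasing_tuples)
    have "mset I = mset (sort I)" by simp
    then obtain p where p: "p permutes {..<length (sort I)}" "permute_list p (sort I) = I"
      by (rule mset_eq_permutation)
    have "F (permute_list p (basis_tuple k j)) = 0"
      using p I by (intro alternating_permute[OF F _ _ basis]) (auto simp: length_basis_tuple j)
    moreover have "permute_list p (basis_tuple k j) = map (\<lambda>a. axis a 1) I"
      using p unfolding basis_tuple_def j(2)[symmetric] by (simp add: permute_list_map)
    ultimately show ?thesis by simp
  qed
  have "\<forall>vs I. length vs = k \<and> length I = k \<and> (\<forall>c<k. m \<le> c \<longrightarrow> vs ! c = axis (I ! c) 1)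
      \<longrightarrow> F vs = 0" if "m \<le> k" for m
    using that
  proof (induction m)
    case 0
    show ?case
    proof (intro allI impI, elim conjE)
      fix vs :: "(real^'n::{finite,linorder}) list" and I :: "'n list"
      assume "length vs = k" "length I = k" "\<forall>c<k. 0 \<le> c \<longrightarrow> vs ! c = axis (I ! c) 1"
      then have "vs = map (\<lambda>a. axis a 1) I" by (intro nth_equalityI) auto
      then show "F vs = 0" using ax \<open>length I = k\<close> by simp
    qed
  next
    case (Suc m)
    show ?case
    proof (intro allI impI, elim conjE)
      fix vs :: "(real^'n::{finite,linorder}) list" and I :: "'n list"
      assume vs: "length vs = k" "length I = k" "\<forall>c<k. Suc m \<le> c \<longrightarrow> vs ! c = axis (I ! c) 1"
      let ?L = "\<lambda>x. F (vs[m := x])"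
      have L: "linear ?L" using alternating_linear[OF F vs(1), of m] Suc.prems by simp
      have e: "?L (axis a 1) = 0" for a
        using Suc.IH[THEN spec, THEN spec, of "vs[m := axis a 1]" "I[m := a]"] Suc.prems vs
        by (auto simp: nth_list_update)
      have "F vs = ?L (\<Sum>a\<in>UNIV. (vs ! m) $ a *\<^sub>R axis a 1)"
        using basis_expansion[of "vs ! m"] by (simp add: scalar_mult_eq_scaleR)
      also have "\<dots> = 0"
        using e by (simp add: linear_sum[OF L] linear_cmul[OF L])
      finally show "F vs = 0" .
    qed
  qed
  from this[of k] vs show ?thesis
    by (metis Ex_list_of_length leD order_refl)
qed

lemma alternating_wedge:
  assumes i: "i < CARD('n) choose k"
  shows "alternating k (\<lambda>vs :: (real^'n::{finite,linorder}) list. wedge vs $v i)"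
proof -
  let ?T = "increasing_tuples k :: 'n list list"
  let ?A = "\<lambda>vs :: (real^'n::{finite,linorder}) list. Matrix.mat k k (\<lambda>(r, c). (vs ! c) $ (?T ! i ! r))"
  have w: "wedge vs $v i = Determinant.det (?A vs)" if "length vs = k" for vs :: "(real^'n::{finite,linorder}) list"
    using that i by (simp add: wedge_def)
  have lin: "linear (\<lambda>x. wedge (vs[c := x]) $v i)"
    if vs: "length vs = k" and c: "c < k" for vs :: "(real^'n::{finite,linorder}) list" and c
  proof -
    have "wedge (vs[c := x]) $v i = (\<Sum>p | p permutes {0..<k}. signof p *
        (x $ (?T ! i ! p c) * (\<Prod>j\<in>{..<k} - {c}. (vs ! j) $ (?T ! i ! p j))))" for x
    proof -
      have "(\<Prod>j<k. ?A (vs[c := x]) $$ (p j, j)) =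
          x $ (?T ! i ! p c) * (\<Prod>j\<in>{..<k} - {c}. (vs ! j) $ (?T ! i ! p j))"
        if p: "p permutes {0..<k}" for p
      proof -
        have pk: "p j < k" if "j < k" for j using permutes_in_image[OF p, of j] that by simp
        have "(\<Prod>j<k. ?A (vs[c := x]) $$ (p j, j)) =
            (\<Prod>j<k. (vs[c := x] ! j) $ (?T ! i ! p j))"
          using pk by (intro prod.cong) auto
        also have "\<dots> = x $ (?T ! i ! p c) *
            (\<Prod>j\<in>{..<k} - {c}. (vs[c := x] ! j) $ (?T ! i ! p j))"
          using c vs by (subst prod.remove[of _ c]) auto
        also have "(\<Prod>j\<in>{..<k} - {c}. (vs[c := x] ! j) $ (?T ! i ! p j)) =
            (\<Prod>j\<in>{..<k} - {c}. (vs ! j) $ (?T ! i ! p j))"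
          by (intro prod.cong) auto
        finally show ?thesis .
      qed
      then show ?thesis
        using vs by (simp add: w det_col[of _ k])
    qed
    then show ?thesis
      by (intro linearI) (simp_all add: algebra_simps sum.distrib sum_distrib_left)
  qed
  have "wedge vs $v i = 0"
    if "length vs = k" "a < b" "b < k" "vs ! a = vs ! b" for vs :: "(real^'n::{finite,linorder}) list" and a b
    unfolding w[OF that(1)] using that
    by (intro det_identical_columns[of _ k a b]) (auto intro!: eq_vecI)
  with lin show ?thesis by (auto simp: alternating_def)
qed

lemma alternating_derivation:
  fixes F :: "(real^'n) list \<Rightarrow> real"
  assumes F: "alternating k F"
  shows "alternating k (\<lambda>vs. \<Sum>c<k. F (vs[c := B *v (vs ! c)]))"
proof -
  have lin: "linear (\<lambda>x. \<Sum>c<k. F (vs[d := x, c := B *v (vs[d := x] ! c)]))"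
    if vs: "length vs = k" and d: "d < k" for vs d
  proof (rule linear_compose_sum, rule ballI)
    fix c assume c: "c \<in> {..<k}"
    show "linear (\<lambda>x. F (vs[d := x, c := B *v (vs[d := x] ! c)]))"
    proof (cases "c = d")
      case True
      have "linear ((\<lambda>x. F (vs[d := x])) \<circ> (*v) B)"
        using alternating_linear[OF F vs d] by (intro linear_compose) auto
      then show ?thesis using True vs d by (simp add: o_def)
    next
      case False
      then show ?thesis
        using alternating_linear[OF F _ d, of "vs[c := B *v (vs ! c)]"] vs
        by (simp add: list_update_swap[of d c])
    qed
  qed
  have alt: "(\<Sum>c<k. F (vs[c := B *v (vs ! c)])) = 0"
    if vs: "length vs = k" and ab: "a < b" "b < k" and eq: "vs ! a = vs ! b" for vs a b
  proof -
    have 0: "F (vs[c := B *v (vs ! c)]) = 0" if "c \<noteq> a" "c \<noteq> b" for c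
      using that vs ab eq by (intro alternating_eq_0[OF F, of _ a b]) auto
    have "(\<Sum>c<k. F (vs[c := B *v (vs ! c)])) = (\<Sum>c\<in>{a, b}. F (vs[c := B *v (vs ! c)]))"
      using ab 0 by (intro sum.mono_neutral_right) auto
    also have "\<dots> = F (vs[a := B *v (vs ! a)]) + F (vs[b := B *v (vs ! b)])"
      using ab by simp
    also have "vs[b := B *v (vs ! b)] = vs[a := vs ! a, b := B *v (vs ! a)]"
      by (simp add: eq[symmetric])
    also have "F \<dots> = - F (vs[a := B *v (vs ! a), b := vs ! a])"
      using alternating_swap[OF F vs, of a b] ab by simp
    also have "vs[a := B *v (vs ! a), b := vs ! a] = vs[a := B *v (vs ! a)]"
      using eq ab by (metis list_update_id list_update_swap less_irrefl)
    finally show ?thesis by simp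
  qed
  from lin alt show ?thesis by (auto simp: alternating_def)
qed

lemma alternating_expansion:
  fixes F :: "(real^'n::{finite,linorder}) list \<Rightarrow> real"
  assumes F: "alternating k F" and vs: "length vs = k"
  shows "F vs = (\<Sum>j<CARD('n) choose k. wedge vs $v j * F (basis_tuple k j))"
proof -
  let ?G = "\<lambda>vs. F vs - (\<Sum>j<CARD('n) choose k. wedge vs $v j * F (basis_tuple k j))"
  have lin: "linear (\<lambda>x. ?G (vs[c := x]))" if "length vs = k" "c < k" for vs c
  proof -
    have "linear (\<lambda>x. wedge (vs[c := x]) $v j * F (basis_tuple k j))" if "j < CARD('n) choose k" for j
    proof -
      note L = alternating_linear[OF alternating_wedge[OF that] \<open>length vs = k\<close> \<open>c < k\<close>]
      show ?thesis
        by (intro linearI) (simp_all add: linear_add[OF L] linear_cmul[OF L] algebra_simps)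
    qed
    then show ?thesis
      using alternating_linear[OF F that] by (intro linear_compose_sub linear_compose_sum) auto
  qed
  have alt: "?G vs = 0" if "length vs = k" "a < b" "b < k" "vs ! a = vs ! b" for vs a b
    using that alternating_eq_0[OF F, of vs a b] alternating_eq_0[OF alternating_wedge, of _ k vs a b]
    by simp
  have "alternating k ?G"
    using lin alt by (auto simp: alternating_def)
  moreover have "?G (basis_tuple k i) = 0" if i: "i < CARD('n) choose k" for i
  proof -
    have "(\<Sum>j<CARD('n) choose k. wedge (basis_tuple k i :: (real^'n::{finite,linorder}) list) $v j * F (basis_tuple k j))
        = (\<Sum>j<CARD('n) choose k. if j = i then F (basis_tuple k j) else 0)"
      using i by (intro sum.cong) (auto simp: wedge_basis_tuple)
    then show ?thesis using i by simp
  qed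
  ultimately have "?G vs = 0"
    using vs by (rule alternating_zero)
  then show ?thesis by simp
qed

theorem additive_compound_wedge:
  fixes B :: "real^'n::{finite,linorder}^'n::{finite,linorder}"
  assumes vs: "length vs = k" and i: "i < CARD('n) choose k"
  shows "(additive_compound k B *\<^sub>v wedge vs) $v i
     = (\<Sum>c<k. wedge (vs[c := B *v (vs ! c)]) $v i)"
proof -
  have "(\<Sum>c<k. wedge (vs[c := B *v (vs ! c)]) $v i) = (\<Sum>j<CARD('n) choose k. wedge vs $v j *
      (\<Sum>c<k. wedge ((basis_tuple k j)[c := B *v (basis_tuple k j ! c)]) $v i))"
    by (rule alternating_expansion[OF alternating_derivation[OF alternating_wedge[OF i]] vs])
  then show ?thesis
    using i vs
    by (simp add: additive_compound_def scalar_prod_def wedge_def[of vs] mult.commute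
        lessThan_atLeast0)
qed

end

theory Submission
  imports Defs
begin

text \<open>Everything is expressed through one condition, the Ky Fan bound: the sum of \<open>v \<bullet> A v\<close> over
  any \<open>k\<close> orthonormal vectors is at most \<open>s\<close>.

  On the spectral side, if a symmetric matrix \<open>A\<close> has the orthonormal eigenvectors $u_1, \dots, u_n$ with
  eigenvalues $\mu_1 \ge \dots \ge \mu_n$, then the wedges of \<open>k\<close> of the $u_i$ form an orthonormal
  eigenbasis of the additive compound, whose eigenvalues are the sums of \<open>k\<close> of the $\mu_i$. So the
  linear matrix inequality for \<open>k\<close> says that $\mu_1 + \dots + \mu_k$ is at most the corresponding sum for
  \<open>M\<close>, and by Ky Fan's maximum principle (\<open>ky_fan\<close>) this is a Ky Fan bound
  (\<open>pos_semidef_additive_compound_iff\<close>).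

  On the convex side, the Ky Fan bounds are linear in \<open>A\<close> and invariant under conjugation, so they hold on
  the whole orbitope. Conversely, a matrix \<open>A\<close> that satisfies them lies in the orbitope because no linear
  functional separates it from this compact convex set. A functional on symmetric matrices is the
  pairing with a symmetric \<open>B\<close>. Writing it in an eigenbasis of \<open>B\<close> with decreasing eigenvalues, summation by parts bounds
  its value at \<open>A\<close> through the Ky Fan bounds and the trace condition by its value at the conjugate of \<open>M\<close>
  that is diagonal in the same basis (\<open>orbit_maximises_linear_functional\<close>).

  The spectral theorem (\<open>eigenbasis_exists\<close>) supplies the eigenbases, and comparing roots of the
  characteristic polynomial identifies the numbers that it produces for \<open>M\<close> with the given eigenvalues
  (\<open>ordered_eigenvalues_eigenbasis\<close>).\<close>

section \<open>Orthonormal lists\<close>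

definition orthonormal :: "'a::real_inner list \<Rightarrow> bool" where
  "orthonormal us \<longleftrightarrow>
     (\<forall>i<length us. \<forall>j<length us. us ! i \<bullet> us ! j = (if i = j then 1 else 0))"

lemma orthonormalD:
  "orthonormal us \<Longrightarrow> i < length us \<Longrightarrow> j < length us \<Longrightarrow> us ! i \<bullet> us ! j = (if i = j then 1 else 0)"
  by (simp add: orthonormal_def)

lemma inner_sum_orthonormal:
  assumes "orthonormal us" "i < length us"
  shows "us ! i \<bullet> (\<Sum>j<length us. f j *\<^sub>R us ! j) = f i"
proof -
  have "us ! i \<bullet> (\<Sum>j<length us. f j *\<^sub>R us ! j) = (\<Sum>j<length us. if j = i then f j else 0)"
    unfolding inner_sum_right using assms by (intro sum.cong) (auto simp: orthonormalD)
  then show ?thesis using assms(2) by simp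
qed

lemma orthonormal_distinct: "orthonormal us \<Longrightarrow> distinct us"
  unfolding distinct_conv_nth orthonormal_def by (metis zero_neq_one)

lemma orthonormal_span:
  fixes us :: "'a::euclidean_space list"
  assumes us: "orthonormal us" and len: "length us = DIM('a)"
  shows "span (set us) = UNIV"
proof -
  have "pairwise real_inner_class.orthogonal (set us)" "0 \<notin> set us"
    using us by (auto simp: pairwise_def real_inner_class.orthogonal_def in_set_conv_nth orthonormal_def)
      (metis inner_zero_left zero_neq_one)
  then have "independent (set us)"
    by (rule pairwise_orthogonal_independent)
  moreover have "card (set us) = DIM('a)"
    using len by (simp add: distinct_card orthonormal_distinct us)
  ultimately show ?thesis
    using card_ge_dim_independent[of "set us" UNIV] by auto
qed

text \<open>The difference of the two sides is orthogonal to the list, hence to its span, which is everything;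
  so it is orthogonal to itself.\<close>

lemma orthonormal_expansion:
  fixes us :: "'a::euclidean_space list"
  assumes us: "orthonormal us" and len: "length us = DIM('a)"
  shows "(\<Sum>i<DIM('a). (us ! i \<bullet> x) *\<^sub>R us ! i) = x"
proof -
  let ?y = "x - (\<Sum>i<length us. (us ! i \<bullet> x) *\<^sub>R us ! i)"
  have "real_inner_class.orthogonal ?y ?y"
  proof (rule orthogonal_to_span)
    show "?y \<in> span (set us)" by (simp add: orthonormal_span[OF us len])
    show "real_inner_class.orthogonal ?y u" if "u \<in> set us" for u
      using that inner_sum_orthonormal[OF us]
      by (auto simp: in_set_conv_nth real_inner_class.orthogonal_def inner_diff_left inner_diff_right inner_commute)
  qed
  then show ?thesis by (simp add: real_inner_class.orthogonal_def len)
qed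

lemma parseval:
  fixes us :: "'a::euclidean_space list"
  assumes us: "orthonormal us" and len: "length us = DIM('a)"
  shows "(\<Sum>i<DIM('a). (us ! i \<bullet> x) * (us ! i \<bullet> y)) = x \<bullet> y"
proof -
  have "x \<bullet> y = (\<Sum>i<DIM('a). (us ! i \<bullet> x) *\<^sub>R us ! i) \<bullet> y"
    by (simp only: orthonormal_expansion[OF us len])
  then show ?thesis by (simp add: inner_sum_left)
qed

lemma bessel:
  assumes us: "orthonormal us"
  shows "(\<Sum>i<length us. (us ! i \<bullet> x)\<^sup>2) \<le> x \<bullet> x"
proof -
  let ?p = "\<Sum>i<length us. (us ! i \<bullet> x) *\<^sub>R us ! i"
  have xp: "x \<bullet> ?p = (\<Sum>i<length us. (us ! i \<bullet> x)\<^sup>2)"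
    by (simp add: inner_sum_right inner_commute power2_eq_square)
  have pp: "?p \<bullet> ?p = (\<Sum>i<length us. (us ! i \<bullet> x)\<^sup>2)"
    by (subst inner_sum_left) (simp add: inner_sum_orthonormal[OF us] power2_eq_square)
  have "0 \<le> (x - ?p) \<bullet> (x - ?p)" by simp
  also have "\<dots> = x \<bullet> x - 2 * (x \<bullet> ?p) + ?p \<bullet> ?p"
    by (simp only: inner_diff_left inner_diff_right inner_commute[of ?p x])
  finally show ?thesis using xp pp by simp
qed

lemma orthonormal_snoc:
  assumes "orthonormal us" "u \<bullet> u = 1" "\<And>i. i < length us \<Longrightarrow> us ! i \<bullet> u = 0"
  shows "orthonormal (us @ [u])"
  using assms by (auto simp: orthonormal_def nth_append less_Suc_eq inner_commute)

lemma unit_vector_orthogonal_to_list: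
  fixes us :: "'a::euclidean_space list"
  assumes "length us < DIM('a)"
  obtains u where "u \<bullet> u = 1" "\<And>i. i < length us \<Longrightarrow> us ! i \<bullet> u = 0"
proof -
  have "dim (set us) < DIM('a)"
    using dim_le_card'[of "set us"] card_length[of us] assms by simp
  then obtain x where x: "x \<noteq> 0" "\<And>y. y \<in> span (set us) \<Longrightarrow> real_inner_class.orthogonal x y"
    using orthogonal_to_subspace_exists by blast
  show ?thesis
  proof
    show "sgn x \<bullet> sgn x = 1"
      using x(1) by (simp add: dot_square_norm norm_sgn)
    show "us ! i \<bullet> sgn x = 0" if "i < length us" for i
      using x(2)[of "us ! i"] that
      by (simp add: span_base sgn_div_norm real_inner_class.orthogonal_def inner_commute)
  qed
qed

section \<open>The spectral theorem\<close>

lemma inner_symmetric_matrix: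
  fixes A :: "real^'n^'n"
  assumes "transpose A = A"
  shows "(A *v x) \<bullet> y = x \<bullet> (A *v y)"
  by (metis assms dot_lmul_matrix transpose_matrix_vector)

text \<open>The gradient of the Rayleigh quotient vanishes at a maximizer. Concretely, \<open>y = A u - c u\<close> is an
  admissible direction, and moving from \<open>u\<close> by \<open>t y\<close> changes \<open>x \<bullet> A x - c (x \<bullet> x)\<close>, which is at most
  0 on \<open>S\<close> and equal to 0 at \<open>u\<close>, by \<open>2 t (y \<bullet> y)\<close> up to second order in \<open>t\<close>; so \<open>y = 0\<close>.\<close>

lemma rayleigh_maximizer_eigenvector:
  fixes A :: "real^'n^'n"
  assumes sym: "transpose A = A" and S: "subspace S" and inv: "\<And>x. x \<in> S \<Longrightarrow> A *v x \<in> S"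
    and u: "u \<in> S" "u \<bullet> u = 1" and max: "\<And>x. x \<in> S \<Longrightarrow> x \<bullet> (A *v x) \<le> c * (x \<bullet> x)"
    and c: "u \<bullet> (A *v u) = c"
  shows "A *v u = c *\<^sub>R u"
proof -
  define y where "y = A *v u - c *\<^sub>R u"
  have y: "y \<in> S"
    unfolding y_def using S u inv by (intro subspace_diff subspace_scale) auto
  define b where "b = y \<bullet> (A *v y) - c * (y \<bullet> y)"
  have quad: "2 * t * (y \<bullet> y) + t\<^sup>2 * b \<le> 0" for t
  proof -
    let ?x = "u + t *\<^sub>R y"
    have "?x \<in> S" using S u y by (intro subspace_add subspace_scale) auto
    then have "?x \<bullet> (A *v ?x) - c * (?x \<bullet> ?x) \<le> 0" using max by fastforce
    moreover have 1: "?x \<bullet> (A *v ?x) = u \<bullet> (A *v u) + 2 * t * (y \<bullet> (A *v u)) + t\<^sup>2 * (y \<bullet> (A *v y))"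
      using inner_symmetric_matrix[OF sym, of u y]
      by (simp add: matrix_vector_right_distrib matrix_vector_mult_scaleR algebra_simps
          inner_commute power2_eq_square)
    moreover have 2: "?x \<bullet> ?x = 1 + 2 * t * (y \<bullet> u) + t\<^sup>2 * (y \<bullet> y)"
      using u(2) by (simp add: algebra_simps inner_commute power2_eq_square)
    moreover have 3: "y \<bullet> y = y \<bullet> (A *v u) - c * (y \<bullet> u)"
      by (subst (2) y_def) (simp add: inner_diff_right)
    have "?x \<bullet> (A *v ?x) - c * (?x \<bullet> ?x) = 2 * t * (y \<bullet> (A *v u) - c * (y \<bullet> u)) + t\<^sup>2 * b"
      unfolding 1 2 c b_def by (simp only: algebra_simps)
    ultimately show ?thesis unfolding 3[symmetric] by argo
  qed
  have "y \<bullet> y \<le> 0"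
  proof (rule ccontr)
    assume "\<not> y \<bullet> y \<le> 0"
    \<comment> \<open>So small that the linear term dominates \<open>t\<^sup>2 * b\<close>.\<close>
    define t where "t = (y \<bullet> y) / (\<bar>b\<bar> + 1)"
    have t: "t > 0" unfolding t_def using \<open>\<not> y \<bullet> y \<le> 0\<close> by (intro divide_pos_pos) linarith+
    have "t * (2 * (y \<bullet> y) + t * b) \<le> 0" using quad[of t] by (simp add: algebra_simps power2_eq_square)
    then have "2 * (y \<bullet> y) + t * b \<le> 0" using t by (simp add: mult_le_0_iff)
    moreover have "t * (\<bar>b\<bar> + 1) = y \<bullet> y" by (simp add: t_def)
    moreover have "t * (\<bar>b\<bar> + b) \<ge> 0" using t by simp
    ultimately show False using t \<open>\<not> y \<bullet> y \<le> 0\<close> by (simp add: algebra_simps)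
  qed
  then have "y = 0" by (metis inner_eq_zero_iff inner_ge_zero order_antisym)
  then show ?thesis by (simp add: y_def)
qed

text \<open>The list is indexed from 0, so \<open>\<mu> 0\<close> is the largest eigenvalue.\<close>

definition eigenbasis :: "real^'n^'n \<Rightarrow> (real^'n) list \<Rightarrow> (nat \<Rightarrow> real) \<Rightarrow> bool" where
  "eigenbasis A us \<mu> \<longleftrightarrow> orthonormal us \<and> length us = CARD('n) \<and>
     (\<forall>i<CARD('n). A *v us ! i = \<mu> i *\<^sub>R us ! i) \<and>
     (\<forall>i j. i \<le> j \<and> j < CARD('n) \<longrightarrow> \<mu> j \<le> \<mu> i)"

lemma eigenbasisD:
  fixes A :: "real^'n^'n"
  assumes "eigenbasis A us \<mu>"
  shows "orthonormal us" "length us = CARD('n)"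
    "i < CARD('n) \<Longrightarrow> A *v us ! i = \<mu> i *\<^sub>R us ! i"
    "i \<le> j \<Longrightarrow> j < CARD('n) \<Longrightarrow> \<mu> j \<le> \<mu> i"
  using assms by (auto simp: eigenbasis_def)

text \<open>Eigenvectors are chosen greedily: the next one maximizes the quadratic form on the unit sphere of the
  orthogonal complement of those already found. The complement is invariant because \<open>A\<close> is symmetric,
  and since the complements shrink, the eigenvalues come out in decreasing order. The last conjunct of
  the induction hypothesis, that \<open>\<mu> i\<close> bounds the form on the remaining complement, carries this
  monotonicity.\<close>

theorem eigenbasis_exists:
  fixes A :: "real^'n^'n"
  assumes sym: "transpose A = A"
  obtains us \<mu> where "eigenbasis A us \<mu>"
proof -
  have "\<exists>us \<mu>. orthonormal us \<and> length us = m \<and> (\<forall>i<m. A *v us ! i = \<mu> i *\<^sub>R us ! i) \<and>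
      (\<forall>i j. i \<le> j \<and> j < m \<longrightarrow> \<mu> j \<le> \<mu> i) \<and>
      (\<forall>x. (\<forall>i<m. us ! i \<bullet> x = 0) \<longrightarrow> (\<forall>i<m. x \<bullet> (A *v x) \<le> \<mu> i * (x \<bullet> x)))"
    if "m \<le> CARD('n)" for m
    using that
  proof (induction m)
    case 0
    show ?case by (intro exI[of _ "[]"]) (simp add: orthonormal_def)
  next
    case (Suc m)
    then obtain us \<mu> where us: "orthonormal us" "length us = m"
      and eig: "\<And>i. i < m \<Longrightarrow> A *v us ! i = \<mu> i *\<^sub>R us ! i"
      and dec: "\<And>i j. i \<le> j \<Longrightarrow> j < m \<Longrightarrow> \<mu> j \<le> \<mu> i"
      and below: "\<And>x i. (\<And>i. i < m \<Longrightarrow> us ! i \<bullet> x = 0) \<Longrightarrow> i < m \<Longrightarrow> x \<bullet> (A *v x) \<le> \<mu> i * (x \<bullet> x)"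
      by (metis Suc_leD)
    define S where "S = {x. \<forall>i<m. us ! i \<bullet> x = 0}"
    have S: "subspace S"
      by (auto simp: S_def subspace_def inner_add_right)
    have inv: "A *v x \<in> S" if "x \<in> S" for x
      using that eig inner_symmetric_matrix[OF sym, of _ x]
      by (auto simp: S_def) (metis inner_scaleR_left mult_zero_right)
    have "compact (sphere 0 1 \<inter> S)"
      using S by (intro compact_Int_closed closed_subspace) auto
    moreover have "sphere 0 1 \<inter> S \<noteq> {}"
    proof -
      have "length us < DIM(real^'n)" using us Suc.prems by simp
      then obtain u where "u \<bullet> u = 1" "\<And>i. i < length us \<Longrightarrow> us ! i \<bullet> u = 0"
        by (rule unit_vector_orthogonal_to_list) blast
      then have "u \<in> sphere 0 1 \<inter> S" using us by (simp add: S_def norm_eq_1)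
      then show ?thesis by blast
    qed
    moreover have "continuous_on (sphere 0 1 \<inter> S) (\<lambda>x. x \<bullet> (A *v x))"
      by (intro continuous_intros linear_continuous_on_compose matrix_vector_mul_linear)
    ultimately obtain u where "u \<in> sphere 0 1 \<inter> S"
      and "\<forall>x\<in>sphere 0 1 \<inter> S. x \<bullet> (A *v x) \<le> u \<bullet> (A *v u)"
      by (rule continuous_attains_sup[THEN bexE])
    then have u: "norm u = 1" "u \<in> S"
      and umax: "\<And>x. norm x = 1 \<Longrightarrow> x \<in> S \<Longrightarrow> x \<bullet> (A *v x) \<le> u \<bullet> (A *v u)"
      by simp_all
    define c where "c = u \<bullet> (A *v u)"
    have uu: "u \<bullet> u = 1" using u by (simp add: norm_eq_1)
    have max: "x \<bullet> (A *v x) \<le> c * (x \<bullet> x)" if "x \<in> S" for x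
    proof (cases "x = 0")
      case False
      have "sgn x \<bullet> (A *v sgn x) \<le> c"
        unfolding c_def using S that False
        by (intro umax) (auto simp: norm_sgn sgn_div_norm subspace_scale)
      moreover have "x = norm x *\<^sub>R sgn x" using False by (simp add: sgn_div_norm)
      then have "x \<bullet> (A *v x) = (norm x)\<^sup>2 * (sgn x \<bullet> (A *v sgn x))"
        by (metis inner_scaleR_left inner_scaleR_right matrix_vector_mult_scaleR mult.assoc power2_eq_square)
      ultimately show ?thesis
        by (simp add: power2_norm_eq_inner mult.commute[of c] mult_left_mono)
    qed simp
    have Au: "A *v u = c *\<^sub>R u"
      by (rule rayleigh_maximizer_eigenvector[OF sym S inv u(2) uu max]) (simp_all add: c_def)
    have on: "orthonormal (us @ [u])"
      using us u uu by (intro orthonormal_snoc) (auto simp: S_def)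
    have c_le: "c \<le> \<mu> i" if "i < m" for i
      using below[of u i] u uu that by (simp add: S_def c_def)
    show ?case
    proof (intro exI[of _ "us @ [u]"] exI[of _ "\<mu>(m := c)"] conjI allI impI)
      show "orthonormal (us @ [u])" "length (us @ [u]) = Suc m" using on us by auto
      show "A *v (us @ [u]) ! i = (\<mu>(m := c)) i *\<^sub>R (us @ [u]) ! i" if "i < Suc m" for i
        using that us eig Au by (auto simp: nth_append less_Suc_eq)
      show "(\<mu>(m := c)) j \<le> (\<mu>(m := c)) i" if "i \<le> j \<and> j < Suc m" for i j
        using that dec c_le by (auto simp: less_Suc_eq)
      show "x \<bullet> (A *v x) \<le> (\<mu>(m := c)) i * (x \<bullet> x)"
        if "\<forall>i<Suc m. (us @ [u]) ! i \<bullet> x = 0" "i < Suc m" for x i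
      proof -
        have "x \<in> S" using that(1) us by (auto simp: S_def nth_append less_Suc_eq)
        then show ?thesis using max below[of x i] that by (auto simp: S_def less_Suc_eq)
      qed
    qed
  qed
  from this[of "CARD('n)"] show ?thesis
    using that by (auto simp: eigenbasis_def)
qed

section \<open>Eigenvalues as roots of the characteristic polynomial\<close>

lemma orthonormal_orthogonal_matrix:
  fixes us :: "(real^'n) list"
  assumes us: "orthonormal us" and h: "bij_betw h (UNIV :: 'n set) {..<length us}"
  shows "orthogonal_matrix (\<chi> i j. us ! h j $ i)"
proof -
  have "us ! h i \<bullet> us ! h j = (if i = j then 1 else 0)" for i j
    using us bij_betw_apply[OF h] bij_betw_imp_inj_on[OF h] by (simp add: orthonormal_def inj_eq)
  then show ?thesis
    by (simp add: orthogonal_matrix Finite_Cartesian_Product.vec_eq_iff matrix_matrix_mult_def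
        Finite_Cartesian_Product.transpose_def Finite_Cartesian_Product.mat_def inner_vec_def)
qed

lemma poly_charpoly:
  "poly (charpoly M) x = Determinants.det (Finite_Cartesian_Product.mat x - M)"
  unfolding charpoly_def Determinants.det_def
  by (auto simp: poly_sum poly_prod of_int_poly Finite_Cartesian_Product.mat_def
      intro!: sum.cong prod.cong)

text \<open>The matrix \<open>P\<close> with the eigenvectors as columns intertwines \<open>x - A\<close> with the diagonal matrix of the
  \<open>x - \<mu> i\<close>, so both have the same determinant for every real \<open>x\<close>.\<close>

lemma charpoly_eigenbasis:
  fixes A :: "real^'n^'n"
  assumes eb: "eigenbasis A us \<mu>"
  shows "charpoly A = (\<Prod>i<CARD('n). [:- \<mu> i, 1:])"
proof -
  obtain h where h: "bij_betw h (UNIV :: 'n set) {..<CARD('n)}"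
    using ex_bij_betw_finite_nat[of "UNIV :: 'n set"] by (auto simp: lessThan_atLeast0)
  then have hn: "h j < CARD('n)" for j by (auto simp: bij_betw_def)
  define P :: "real^'n^'n" where "P = (\<chi> i j. us ! h j $ i)"
  have "Determinants.det P \<noteq> 0"
    using det_orthogonal_matrix[OF orthonormal_orthogonal_matrix, of us h] h eigenbasisD(1,2)[OF eb]
    by (auto simp: P_def)
  have "poly (charpoly A) x = poly (\<Prod>i<CARD('n). [:- \<mu> i, 1:]) x" for x
  proof -
    let ?X = "Finite_Cartesian_Product.mat x - A"
    define D :: "real^'n^'n" where "D = (\<chi> i j. if i = j then x - \<mu> (h j) else 0)"
    have scalar: "Finite_Cartesian_Product.mat x *v v = x *\<^sub>R v" for v :: "real^'n"
      by (simp add: Finite_Cartesian_Product.vec_eq_iff matrix_vector_mult_def Finite_Cartesian_Product.mat_def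
          if_distrib if_distribR cong: if_cong)
    have "?X *v us ! h j = (x - \<mu> (h j)) *\<^sub>R us ! h j" for j
      using eigenbasisD(3)[OF eb hn]
      by (simp add: matrix_vector_mult_diff_rdistrib scalar scaleR_left_diff_distrib)
    then have "(\<Sum>k\<in>UNIV. ?X $ i $ k * us ! h j $ k) = us ! h j $ i * (x - \<mu> (h j))" for i j
      unfolding Finite_Cartesian_Product.vec_eq_iff matrix_vector_mult_def by simp
    then have "(?X ** P) $ i $ j = (P ** D) $ i $ j" for i j
      by (simp add: matrix_matrix_mult_def P_def D_def if_distrib cong: if_cong
          del: vector_minus_component)
    then have "?X ** P = P ** D"
      by (simp only: Finite_Cartesian_Product.vec_eq_iff) blast
    then have "Determinants.det ?X = Determinants.det D"
      using \<open>Determinants.det P \<noteq> 0\<close> by (metis Determinants.det_mul mult.commute mult_cancel_right)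
    also have "\<dots> = (\<Prod>j\<in>UNIV. x - \<mu> (h j))"
      by (subst Determinants.det_diagonal) (auto simp: D_def)
    also have "\<dots> = (\<Prod>i<CARD('n). x - \<mu> i)"
      by (rule prod.reindex_bij_betw[OF h])
    finally show ?thesis by (simp add: poly_charpoly poly_prod)
  qed
  then show ?thesis by (simp add: poly_eq_poly_eq_iff[symmetric] fun_eq_iff)
qed

text \<open>The polynomial determines the multiset of its roots, and a multiset has only one decreasing
  enumeration.\<close>

lemma decreasing_roots_unique:
  fixes f g :: "nat \<Rightarrow> 'a::{idom,linorder}"
  assumes eq: "(\<Prod>i<n. [:- f i, 1:]) = (\<Prod>i<n. [:- g i, 1:])"
    and f: "\<And>i j. i \<le> j \<Longrightarrow> j < n \<Longrightarrow> f j \<le> f i"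
    and g: "\<And>i j. i \<le> j \<Longrightarrow> j < n \<Longrightarrow> g j \<le> g i"
    and i: "i < n"
  shows "f i = g i"
proof -
  have "(\<Sum>i<m. {#h i#}) = mset (map h [0..<m])" for h :: "nat \<Rightarrow> 'a" and m
    by (induction m) simp_all
  then have roots: "proots (\<Prod>i<n. [:- h i, 1:]) = mset (rev (map h [0..<n]))" for h :: "nat \<Rightarrow> 'a"
    by (simp add: proots_prod)
  have sorted: "sorted (rev (map h [0..<n]))"
    if "\<And>i j. i \<le> j \<Longrightarrow> j < n \<Longrightarrow> h j \<le> h i" for h :: "nat \<Rightarrow> 'a"
    using that by (auto simp: sorted_iff_nth_mono rev_nth)
  have "sort (rev (map g [0..<n])) = rev (map f [0..<n])"
    using eq roots[of f] roots[of g] by (intro properties_for_sort sorted f) auto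
  moreover have "sort (rev (map g [0..<n])) = rev (map g [0..<n])"
    by (intro properties_for_sort sorted g) auto
  ultimately show ?thesis
    using i by (simp add: map_eq_conv)
qed

lemma ordered_eigenvalues_eigenbasis:
  fixes M :: "real^'n^'n"
  assumes lam: "ordered_eigenvalues M lam" and eb: "eigenbasis M us \<mu>" and i: "i < CARD('n)"
  shows "lam (Suc i) = \<mu> i"
proof (rule decreasing_roots_unique[OF _ _ _ i])
  show "(\<Prod>i<CARD('n). [:- lam (Suc i), 1:]) = (\<Prod>i<CARD('n). [:- \<mu> i, 1:])"
    using lam charpoly_eigenbasis[OF eb]
    by (simp add: ordered_eigenvalues_def prod.atLeast1_atMost_eq)
qed (use lam eigenbasisD(4)[OF eb] in \<open>auto simp: ordered_eigenvalues_def\<close>)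

section \<open>Ky Fan's maximum principle\<close>

lemma eigenbasis_apply:
  fixes A :: "real^'n^'n"
  assumes eb: "eigenbasis A us \<mu>"
  shows "A *v x = (\<Sum>i<CARD('n). (\<mu> i * (us ! i \<bullet> x)) *\<^sub>R us ! i)"
proof -
  have "A *v x = A *v (\<Sum>i<CARD('n). (us ! i \<bullet> x) *\<^sub>R us ! i)"
    using orthonormal_expansion[OF eigenbasisD(1)[OF eb]] eigenbasisD(2)[OF eb] by simp
  also have "\<dots> = (\<Sum>i<CARD('n). (\<mu> i * (us ! i \<bullet> x)) *\<^sub>R us ! i)"
    by (simp add: linear_sum[OF matrix_vector_mul_linear] matrix_vector_mult_scaleR
        eigenbasisD(3)[OF eb] mult.commute)
  finally show ?thesis .
qed

lemma eigenbasis_quadratic_form: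
  fixes A :: "real^'n^'n"
  assumes eb: "eigenbasis A us \<mu>"
  shows "x \<bullet> (A *v x) = (\<Sum>i<CARD('n). \<mu> i * (us ! i \<bullet> x)\<^sup>2)"
  unfolding eigenbasis_apply[OF eb]
  by (simp add: inner_sum_right inner_commute power2_eq_square mult.assoc)

text \<open>This is the trace pairing with the spectral decomposition \<open>B = (\<Sum>i. \<beta> i b\<^sub>i b\<^sub>i\<^sup>T)\<close>: on matrices the
  inner product is the sum of the products of entries, and the rank-one matrix \<open>b b\<^sup>T\<close> pairs with \<open>X\<close>
  to \<open>b \<bullet> X b\<close>.\<close>

lemma inner_eigenbasis:
  fixes B :: "real^'n^'n"
  assumes eb: "eigenbasis B bs \<beta>"
  shows "B \<bullet> X = (\<Sum>i<CARD('n). \<beta> i * (bs ! i \<bullet> (X *v bs ! i)))"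
proof -
  have entry: "B $ r $ s = (\<Sum>i<CARD('n). \<beta> i * bs ! i $ r * bs ! i $ s)" for r s
  proof -
    have "B $ r $ s = (B *v axis s 1) $ r" by (simp add: matrix_vector_mul_component inner_axis)
    then show ?thesis
      unfolding eigenbasis_apply[OF eb] by (simp add: sum_component inner_axis mult_ac)
  qed
  have "B \<bullet> X = (\<Sum>r\<in>UNIV. \<Sum>s\<in>UNIV. \<Sum>i<CARD('n). \<beta> i * bs ! i $ r * bs ! i $ s * X $ r $ s)"
    by (simp add: inner_vec_def entry sum_distrib_right)
  also have "\<dots> = (\<Sum>r\<in>UNIV. \<Sum>i<CARD('n). \<Sum>s\<in>UNIV. \<beta> i * bs ! i $ r * bs ! i $ s * X $ r $ s)"
    by (intro sum.cong refl sum.swap)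
  also have "\<dots> = (\<Sum>i<CARD('n). \<Sum>r\<in>UNIV. \<Sum>s\<in>UNIV. \<beta> i * bs ! i $ r * bs ! i $ s * X $ r $ s)"
    by (rule sum.swap)
  also have "\<dots> = (\<Sum>i<CARD('n). \<beta> i * (bs ! i \<bullet> (X *v bs ! i)))"
    by (simp add: inner_vec_def matrix_vector_mult_def sum_distrib_left mult_ac)
  finally show ?thesis .
qed

text \<open>The preceding identity for the identity matrix, for which every orthonormal basis is an eigenbasis.\<close>

lemma trace_orthonormal:
  fixes X :: "real^'n^'n"
  assumes us: "orthonormal us" "length us = CARD('n)"
  shows "Determinants.trace X = (\<Sum>i<CARD('n). us ! i \<bullet> (X *v us ! i))"
proof -
  have "eigenbasis (Finite_Cartesian_Product.mat 1 :: real^'n^'n) us (\<lambda>_. 1)"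
    using us by (simp add: eigenbasis_def)
  moreover have "Finite_Cartesian_Product.mat 1 \<bullet> X = Determinants.trace X"
    by (simp add: inner_vec_def Finite_Cartesian_Product.mat_def Determinants.trace_def
        if_distrib if_distribR cong: if_cong)
  ultimately show ?thesis
    using inner_eigenbasis by fastforce
qed

text \<open>A total weight of \<open>k\<close> with at most 1 on each index is best spent on the \<open>k\<close> largest values. With the
  threshold \<open>c\<close> equal to the \<open>k\<close>-th largest value and \<open>e\<close> the indicator of the first \<open>k\<close> indices, each
  product \<open>(\<mu> i - c) * (e i - p i)\<close> is nonnegative, and as \<open>e\<close> and \<open>p\<close> have the same total, \<open>c\<close> cancels
  in the sum.\<close>

lemma weighted_sum_le_top_sum:
  fixes \<mu> p :: "nat \<Rightarrow> real"
  assumes k: "k \<le> n" and dec: "\<And>i j. i \<le> j \<Longrightarrow> j < n \<Longrightarrow> \<mu> j \<le> \<mu> i"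
    and p: "\<And>i. i < n \<Longrightarrow> 0 \<le> p i" "\<And>i. i < n \<Longrightarrow> p i \<le> 1" and sum: "(\<Sum>i<n. p i) = real k"
  shows "(\<Sum>i<n. \<mu> i * p i) \<le> (\<Sum>i<k. \<mu> i)"
proof (cases "k = 0")
  case True
  then have "p i = 0" if "i < n" for i
    using sum p that sum_nonneg_eq_0_iff[of "{..<n}" p] by auto
  then show ?thesis using True by simp
next
  case False
  define c where "c = \<mu> (k - 1)"
  define e :: "nat \<Rightarrow> real" where "e i = (if i < k then 1 else 0)" for i
  have restrict: "(\<Sum>i<n. a i * e i) = (\<Sum>i<k. a i)" for a :: "nat \<Rightarrow> real"
  proof -
    have "(\<Sum>i<n. a i * e i) = (\<Sum>i<k. a i * e i)"
      using k by (intro sum.mono_neutral_right) (auto simp: e_def)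
    then show ?thesis by (simp add: e_def)
  qed
  have "0 \<le> (\<Sum>i<n. (\<mu> i - c) * (e i - p i))"
  proof (rule sum_nonneg)
    fix i assume "i \<in> {..<n}"
    then have i: "i < n" by simp
    show "0 \<le> (\<mu> i - c) * (e i - p i)"
    proof (cases "i < k")
      case True
      then have "c \<le> \<mu> i" unfolding c_def using k by (intro dec) auto
      then show ?thesis using True p(2)[OF i] by (simp add: e_def)
    next
      case False
      then have "\<mu> i \<le> c" unfolding c_def using i by (intro dec) auto
      then show ?thesis using False p(1)[OF i] by (simp add: e_def mult_nonpos_nonneg)
    qed
  qed
  also have "\<dots> = (\<Sum>i<n. \<mu> i * e i) - (\<Sum>i<n. \<mu> i * p i) - c * (\<Sum>i<n. 1 * e i) + c * (\<Sum>i<n. p i)"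
    by (simp add: algebra_simps sum.distrib sum_subtractf sum_distrib_left)
  also have "\<dots> = (\<Sum>i<k. \<mu> i) - (\<Sum>i<n. \<mu> i * p i)"
    unfolding restrict sum by simp
  finally show ?thesis by simp
qed

text \<open>Expanding the quadratic form in the eigenbasis gives the eigenvalue \<open>\<mu> i\<close> the weight \<open>p i\<close>, the squared
  length of the projection of the \<open>i\<close>-th eigenvector to the span of \<open>vs\<close>. Bessel's inequality bounds each
  weight by 1, and by Parseval's identity the weights add up to the length of \<open>vs\<close>.\<close>

theorem ky_fan:
  fixes A :: "real^'n^'n"
  assumes eb: "eigenbasis A us \<mu>" and vs: "orthonormal vs" "length vs \<le> CARD('n)"
  shows "(\<Sum>c<length vs. vs ! c \<bullet> (A *v vs ! c)) \<le> (\<Sum>i<length vs. \<mu> i)"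
proof -
  define p where "p i = (\<Sum>c<length vs. (us ! i \<bullet> vs ! c)\<^sup>2)" for i
  have "(\<Sum>c<length vs. vs ! c \<bullet> (A *v vs ! c)) = (\<Sum>i<CARD('n). \<mu> i * p i)"
    unfolding eigenbasis_quadratic_form[OF eb] p_def by (subst sum.swap) (simp add: sum_distrib_left)
  also have "\<dots> \<le> (\<Sum>i<length vs. \<mu> i)"
  proof (rule weighted_sum_le_top_sum[OF vs(2)])
    show "\<mu> j \<le> \<mu> i" if "i \<le> j" "j < CARD('n)" for i j
      using eigenbasisD(4)[OF eb that] .
    show "0 \<le> p i" for i by (simp add: p_def sum_nonneg)
    show "p i \<le> 1" if "i < CARD('n)" for i
      using bessel[OF vs(1), of "us ! i"] orthonormalD[OF eigenbasisD(1)[OF eb], of i i] that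
      by (simp add: p_def inner_commute eigenbasisD(2)[OF eb])
    have "(\<Sum>i<CARD('n). p i) = (\<Sum>c<length vs. \<Sum>i<CARD('n). (us ! i \<bullet> vs ! c) * (us ! i \<bullet> vs ! c))"
      unfolding p_def power2_eq_square by (rule sum.swap)
    also have "\<dots> = (\<Sum>c<length vs. vs ! c \<bullet> vs ! c)"
      using parseval[OF eigenbasisD(1)[OF eb]] by (simp add: eigenbasisD(2)[OF eb])
    also have "\<dots> = real (length vs)"
      by (simp add: orthonormalD[OF vs(1)])
    finally show "(\<Sum>i<CARD('n). p i) = real (length vs)" .
  qed
  finally show ?thesis .
qed

text \<open>The basis-free form of an upper bound on the sum of the \<open>k\<close> largest eigenvalues. For a fixed list it is
  a linear condition on the matrix, which makes convexity evident.\<close>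

definition ky_fan_bound :: "nat \<Rightarrow> real^'n^'n \<Rightarrow> real \<Rightarrow> bool" where
  "ky_fan_bound k A s \<longleftrightarrow>
     (\<forall>vs. orthonormal vs \<and> length vs = k \<longrightarrow> (\<Sum>c<k. vs ! c \<bullet> (A *v vs ! c)) \<le> s)"

section \<open>The spectrum of an additive compound\<close>

lemma alternating_compose_linear:
  fixes f :: "real^'m \<Rightarrow> real^'n"
  assumes F: "alternating k F" and f: "linear f"
  shows "alternating k (\<lambda>vs. F (map f vs))"
  unfolding alternating_def
proof (intro conjI allI impI; elim conjE)
  show "linear (\<lambda>x. F (map f (vs[c := x])))" if "length vs = k" "c < k" for vs c
    using linear_compose[OF f alternating_linear[OF F, of "map f vs" c]] that
    by (simp add: map_update o_def)
  show "F (map f vs) = 0" if "length vs = k" "a < b" "b < k" "vs ! a = vs ! b" for vs a b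
    using that by (intro alternating_eq_0[OF F, of _ a b]) auto
qed

definition orthonormal_frame :: "('n::finite \<Rightarrow> real^'n) \<Rightarrow> bool" where
  "orthonormal_frame u \<longleftrightarrow> (\<forall>a b. u a \<bullet> u b = (if a = b then 1 else 0))"

definition wedge_matrix :: "nat \<Rightarrow> ('n::{finite,linorder} \<Rightarrow> real^'n::{finite,linorder}) \<Rightarrow> real Matrix.mat" where
  "wedge_matrix k u = Matrix.mat (CARD('n) choose k) (CARD('n) choose k)
     (\<lambda>(i, j). wedge (map u (increasing_tuples k ! j)) $v i)"

lemma wedge_matrix_carrier:
  "wedge_matrix k (u :: 'n::{finite,linorder} \<Rightarrow> _) \<in> carrier_mat (CARD('n) choose k) (CARD('n) choose k)"
  by (simp add: wedge_matrix_def)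

lemma col_wedge_matrix:
  fixes u :: "'n::{finite,linorder} \<Rightarrow> real^'n::{finite,linorder}"
  assumes "j < CARD('n) choose k"
  shows "col (wedge_matrix k u) j = wedge (map u (increasing_tuples k ! j))"
  using assms by (intro eq_vecI) (auto simp: wedge_matrix_def wedge_def increasing_tuples_nth)

text \<open>Wedges of an orthonormal basis are orthonormal, a case of the Cauchy-Binet formula. Let \<open>C\<close> be the
  isometry taking \<open>u a\<close> to the \<open>a\<close>-th standard basis vector. Taking the wedge after \<open>C\<close> is alternating,
  hence determined by its values on standard basis tuples, and these values are determinants of the
  transposes of the minors that are the coordinates of the wedges of \<open>u\<close>. Thus the scalar products in question are the coordinates
  of wedges of standard basis vectors.\<close>

lemma wedge_matrix_orthogonal:
  fixes u :: "'n::{finite,linorder} \<Rightarrow> real^'n::{finite,linorder}"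
  assumes u: "orthonormal_frame u"
  shows "transpose_mat (wedge_matrix k u) * wedge_matrix k u = 1\<^sub>m (CARD('n) choose k)"
proof (rule eq_matI)
  let ?T = "increasing_tuples k :: 'n list list"
  let ?N = "CARD('n) choose k"
  fix i l assume "i < dim_row (1\<^sub>m ?N :: real Matrix.mat)" "l < dim_col (1\<^sub>m ?N :: real Matrix.mat)"
  then have i: "i < ?N" and l: "l < ?N" by auto
  define C where "C x = (\<chi> a. u a \<bullet> x)" for x
  have C: "linear C"
    by (rule linearI) (simp_all add: C_def Finite_Cartesian_Product.vec_eq_iff inner_add_right)
  have Cu: "C (u a) = axis a 1" for a
    using u by (auto simp: C_def orthonormal_frame_def axis_def Finite_Cartesian_Product.vec_eq_iff)
  have coord: "wedge (map C (basis_tuple k j)) $v i = wedge (map u (?T ! i)) $v j" if j: "j < ?N" for j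
  proof -
    let ?A = "Matrix.mat k k (\<lambda>(r, c). u (?T ! i ! r) $ (?T ! j ! c))"
    have "wedge (map C (basis_tuple k j)) $v i = Determinant.det ?A"
      using i j by (auto simp: wedge_def basis_tuple_def C_def inner_axis increasing_tuples_nth
          intro!: arg_cong[where f = Determinant.det] eq_matI)
    also have "\<dots> = Determinant.det (transpose_mat ?A)"
      by (rule Determinant.det_transpose[of _ k, symmetric]) (rule mat_carrier)
    also have "\<dots> = wedge (map u (?T ! i)) $v j"
      using i j by (auto simp: wedge_def increasing_tuples_nth
          intro!: arg_cong[where f = Determinant.det] eq_matI)
    finally show ?thesis .
  qed
  have "(transpose_mat (wedge_matrix k u) * wedge_matrix k u) $$ (i, l)
      = (\<Sum>j<?N. wedge (map u (?T ! l)) $v j * wedge (map u (?T ! i)) $v j)"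
    using i l by (simp add: wedge_matrix_def scalar_prod_def mult.commute lessThan_atLeast0)
  also have "\<dots> = (\<Sum>j<?N. wedge (map u (?T ! l)) $v j * wedge (map C (basis_tuple k j)) $v i)"
    by (simp add: coord)
  also have "\<dots> = wedge (map C (map u (?T ! l))) $v i"
    using l by (intro alternating_expansion[symmetric] alternating_compose_linear[OF alternating_wedge C] i)
      (simp add: increasing_tuples_nth)
  also have "map C (map u (?T ! l)) = basis_tuple k l"
    by (simp add: basis_tuple_def Cu)
  finally show "(transpose_mat (wedge_matrix k u) * wedge_matrix k u) $$ (i, l) = 1\<^sub>m ?N $$ (i, l)"
    using i l by (simp add: wedge_basis_tuple)
qed (simp_all add: wedge_matrix_def)

lemma additive_compound_carrier:
  "additive_compound k (B :: real^'n::{finite,linorder}^'n::{finite,linorder}) \<in> carrier_mat (CARD('n) choose k) (CARD('n) choose k)"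
  by (simp add: additive_compound_def)

text \<open>Each of the \<open>k\<close> terms of the derivation multiplies one factor of the wedge, hence the wedge, by an
  eigenvalue.\<close>

lemma additive_compound_wedge_eigenvectors:
  fixes B :: "real^'n::{finite,linorder}^'n::{finite,linorder}"
  assumes vs: "length vs = k" and eig: "\<And>c. c < k \<Longrightarrow> B *v vs ! c = m c *\<^sub>R vs ! c"
  shows "additive_compound k B *\<^sub>v wedge vs = (\<Sum>c<k. m c) \<cdot>\<^sub>v wedge vs"
proof (rule eq_vecI)
  fix i assume "i < dim_vec ((\<Sum>c<k. m c) \<cdot>\<^sub>v wedge vs)"
  then have i: "i < CARD('n) choose k" using vs by (simp add: wedge_def)
  have "wedge (vs[c := B *v vs ! c]) $v i = m c * wedge vs $v i" if "c < k" for c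
    using linear_cmul[OF alternating_linear[OF alternating_wedge[OF i] vs that], of "m c" "vs ! c"]
    by (simp add: eig[OF that])
  then show "(additive_compound k B *\<^sub>v wedge vs) $v i = ((\<Sum>c<k. m c) \<cdot>\<^sub>v wedge vs) $v i"
    using i vs by (subst additive_compound_wedge[OF vs i]) (simp add: sum_distrib_right wedge_def[of vs])
qed (use vs in \<open>simp add: additive_compound_def wedge_def\<close>)

text \<open>The hypotheses say that \<open>Q = W E W\<^sup>T\<close> with \<open>E\<close> diagonal and \<open>W\<close> orthogonal. In particular \<open>Q\<close> is
  symmetric, and its quadratic form at \<open>v\<close> is the weighted sum of the squared coordinates of \<open>W\<^sup>T v\<close>.\<close>

lemma pos_semidef_iff_eigenvalues_nonneg:
  fixes Q W :: "real Matrix.mat"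
  assumes Q: "Q \<in> carrier_mat N N" and W: "W \<in> carrier_mat N N"
    and orth: "transpose_mat W * W = 1\<^sub>m N"
    and eig: "\<And>j. j < N \<Longrightarrow> Q *\<^sub>v col W j = e j \<cdot>\<^sub>v col W j"
  shows "pos_semidef Q \<longleftrightarrow> (\<forall>j<N. 0 \<le> e j)"
proof
  assume psd: "pos_semidef Q"
  show "\<forall>j<N. 0 \<le> e j"
  proof (intro allI impI)
    fix j assume j: "j < N"
    have c: "col W j \<in> carrier_vec N" using W j by auto
    have "(transpose_mat W * W) $$ (j, j) = scalar_prod (col W j) (col W j)"
      using W j by simp
    then have "scalar_prod (col W j) (col W j) = 1" using orth j by simp
    then have "scalar_prod (col W j) (Q *\<^sub>v col W j) = e j"
      using c by (simp add: eig[OF j])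
    then show "0 \<le> e j"
      using psd c Q by (auto simp: pos_semidef_def)
  qed
next
  assume nonneg: "\<forall>j<N. 0 \<le> e j"
  define E where "E = Matrix.mat N N (\<lambda>(i, j). if i = j then e i else 0)"
  have E: "E \<in> carrier_mat N N" "transpose_mat E = E"
    by (auto simp: E_def)
  have Wt: "transpose_mat W \<in> carrier_mat N N" using W by simp
  have inverse: "W * transpose_mat W = 1\<^sub>m N"
    by (rule mat_mult_left_right_inverse[OF Wt W orth])
  have QW: "Q * W = W * E"
  proof (rule eq_matI)
    fix i j assume "i < dim_row (W * E)" "j < dim_col (W * E)"
    then have i: "i < N" and j: "j < N" using W E by auto
    have "(Q * W) $$ (i, j) = (Q *\<^sub>v col W j) $v i" using Q W i j by simp
    also have "\<dots> = e j * W $$ (i, j)" using W i j by (simp add: eig)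
    also have "\<dots> = (W * E) $$ (i, j)"
      using W i j by (simp add: E_def scalar_prod_def mult_delta_right mult.commute)
    finally show "(Q * W) $$ (i, j) = (W * E) $$ (i, j)" .
  qed (use Q W E in auto)
  have "Q = Q * (W * transpose_mat W)" using Q by (simp add: inverse)
  also have "\<dots> = W * E * transpose_mat W"
    using assoc_mult_mat[OF Q W Wt] by (simp add: QW)
  finally have Q_eq: "Q = W * E * transpose_mat W" .
  have WE: "W * E \<in> carrier_mat N N" using W E by simp
  have "transpose_mat Q = transpose_mat (transpose_mat W) * transpose_mat (W * E)"
    unfolding Q_eq by (rule transpose_mult[OF WE Wt])
  also have "\<dots> = W * (E * transpose_mat W)"
    using transpose_mult[OF W E(1)] E by simp
  also have "\<dots> = Q"
    unfolding Q_eq by (rule assoc_mult_mat[OF W E(1) Wt, symmetric])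
  finally have "transpose_mat Q = Q" .
  moreover have "0 \<le> scalar_prod v (Q *\<^sub>v v)" if "v \<in> carrier_vec (dim_row Q)" for v
  proof -
    have v: "v \<in> carrier_vec N" using that Q by simp
    define w where "w = transpose_mat W *\<^sub>v v"
    have w: "w \<in> carrier_vec N" unfolding w_def using Wt v by (rule mult_mat_vec_carrier)
    have Ew: "E *\<^sub>v w \<in> carrier_vec N" using E(1) w by (rule mult_mat_vec_carrier)
    have "Q *\<^sub>v v = W *\<^sub>v (E *\<^sub>v w)"
      unfolding Q_eq assoc_mult_mat_vec[OF WE Wt v] w_def[symmetric]
      by (rule assoc_mult_mat_vec[OF W E(1) w])
    then have "scalar_prod v (Q *\<^sub>v v) = scalar_prod w (E *\<^sub>v w)"
      using transpose_vec_mult_scalar[OF W Ew v] by (simp add: w_def)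
    also have "\<dots> = (\<Sum>l\<in>{0..<N}. w $v l * (e l * w $v l))"
    proof -
      have "(E *\<^sub>v w) $v l = e l * w $v l" if l: "l < N" for l
        using l w by (simp add: E_def scalar_prod_def mult_delta_left)
      then show ?thesis using carrier_vecD[OF Ew] by (simp only: scalar_prod_def) simp
    qed
    also have "0 \<le> \<dots>"
      using nonneg by (intro sum_nonneg) (simp add: mult.left_commute[of _ "e _"])
    finally show ?thesis .
  qed
  ultimately show "pos_semidef Q" by (simp add: pos_semidef_def)
qed

text \<open>The wedges of \<open>k\<close> different eigenvectors of \<open>A\<close> form an orthonormal eigenbasis of the additive compound,
  with the sums of \<open>k\<close> eigenvalues of \<open>A\<close> as eigenvalues. Hence the left-hand side says that no sum of
  \<open>k\<close> eigenvalues with different indices exceeds \<open>s\<close>. By Ky Fan's principle the largest of these sums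
  bounds the quadratic form on all orthonormal \<open>k\<close>-tuples, and each such sum is attained on a tuple of
  eigenvectors.\<close>

theorem pos_semidef_additive_compound_iff:
  fixes A :: "real^'n::{finite,linorder}^'n::{finite,linorder}"
  assumes sym: "transpose A = A" and k: "k \<le> CARD('n)"
  shows "pos_semidef (s \<cdot>\<^sub>m 1\<^sub>m (CARD('n) choose k) - additive_compound k A) \<longleftrightarrow> ky_fan_bound k A s"
proof -
  let ?N = "CARD('n) choose k"
  let ?T = "increasing_tuples k :: 'n list list"
  let ?Q = "s \<cdot>\<^sub>m 1\<^sub>m ?N - additive_compound k A"
  obtain us \<mu> where eb: "eigenbasis A us \<mu>" using eigenbasis_exists[OF sym] .
  obtain h where h: "bij_betw h (UNIV :: 'n set) {..<CARD('n)}"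
    using ex_bij_betw_finite_nat[of "UNIV :: 'n set"] by (auto simp: lessThan_atLeast0)
  have hn: "h a < CARD('n)" for a using bij_betw_apply[OF h] by simp
  define u where "u a = us ! h a" for a
  have u: "orthonormal_frame u"
    using eigenbasisD(1,2)[OF eb] hn bij_betw_imp_inj_on[OF h]
    by (simp add: orthonormal_frame_def u_def orthonormal_def inj_eq)
  have Au: "A *v u a = \<mu> (h a) *\<^sub>R u a" for a
    using eigenbasisD(3)[OF eb hn] by (simp add: u_def)
  have spectrum: "pos_semidef ?Q \<longleftrightarrow> (\<forall>j<?N. 0 \<le> s - (\<Sum>c<k. \<mu> (h (?T ! j ! c))))"
  proof (rule pos_semidef_iff_eigenvalues_nonneg[OF _ wedge_matrix_carrier wedge_matrix_orthogonal[OF u]])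
    show "?Q \<in> carrier_mat ?N ?N" using additive_compound_carrier[of k A] by (simp add: minus_carrier_mat)
    fix j assume j: "j < ?N"
    let ?w = "wedge (map u (?T ! j)) :: real Matrix.vec"
    have w: "?w \<in> carrier_vec ?N" using j by (simp add: wedge_def increasing_tuples_nth)
    have "additive_compound k A *\<^sub>v ?w = (\<Sum>c<k. \<mu> (h (?T ! j ! c))) \<cdot>\<^sub>v ?w"
      using j by (intro additive_compound_wedge_eigenvectors) (auto simp: increasing_tuples_nth Au)
    moreover have "?Q *\<^sub>v ?w = (s \<cdot>\<^sub>m 1\<^sub>m ?N) *\<^sub>v ?w - additive_compound k A *\<^sub>v ?w"
      using w additive_compound_carrier[of k A] by (intro minus_mult_distrib_mat_vec) auto
    moreover have "(s \<cdot>\<^sub>m 1\<^sub>m ?N) *\<^sub>v ?w = s \<cdot>\<^sub>v ?w"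
      using w by (intro eq_vecI) (auto simp: scalar_prod_def if_distrib if_distribR cong: if_cong)
    ultimately have "?Q *\<^sub>v ?w = (s - (\<Sum>c<k. \<mu> (h (?T ! j ! c)))) \<cdot>\<^sub>v ?w"
      using w by (intro eq_vecI) (auto simp: algebra_simps)
    then show "?Q *\<^sub>v col (wedge_matrix k u) j =
        (s - (\<Sum>c<k. \<mu> (h (?T ! j ! c)))) \<cdot>\<^sub>v col (wedge_matrix k u) j"
      by (simp add: col_wedge_matrix[OF j])
  qed
  show ?thesis
    unfolding spectrum
  proof
    assume nonneg: "\<forall>j<?N. 0 \<le> s - (\<Sum>c<k. \<mu> (h (?T ! j ! c)))"
    \<comment> \<open>The positions of the \<open>k\<close> largest eigenvalues.\<close>
    define J where "J = h -` {..<k}"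
    have "h ` J = {..<k}"
      using bij_betw_imp_surj_on[OF h] k by (auto simp: J_def image_vimage_eq)
    then have hJ: "bij_betw h J {..<k}"
      by (intro bij_betw_subset[OF h]) auto
    define I where "I = sorted_list_of_set J"
    have "length I = k" using bij_betw_same_card[OF hJ] by (simp add: I_def)
    then have "I \<in> set ?T" by (simp add: set_increasing_tuples I_def)
    then obtain j where j: "j < ?N" "?T ! j = I"
      by (auto simp: in_set_conv_nth length_increasing_tuples)
    have "bij_betw ((!) I) {..<k} J"
      using \<open>length I = k\<close> by (intro bij_betw_nth) (auto simp: I_def)
    then have "bij_betw (\<lambda>c. h (I ! c)) {..<k} {..<k}"
      using bij_betw_trans[OF _ hJ] by (fastforce simp: o_def)
    then have "(\<Sum>c<k. \<mu> (h (I ! c))) = (\<Sum>i<k. \<mu> i)"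
      by (rule sum.reindex_bij_betw)
    then have "(\<Sum>i<k. \<mu> i) \<le> s" using nonneg j by fastforce
    then show "ky_fan_bound k A s"
      using ky_fan[OF eb] k by (fastforce simp: ky_fan_bound_def)
  next
    assume bound: "ky_fan_bound k A s"
    show "\<forall>j<?N. 0 \<le> s - (\<Sum>c<k. \<mu> (h (?T ! j ! c)))"
    proof (intro allI impI)
      fix j assume j: "j < ?N"
      note I = increasing_tuples_nth[OF j]
      have "orthonormal (map u (?T ! j))"
        using u I by (simp add: orthonormal_def orthonormal_frame_def strict_sorted_iff nth_eq_iff_index_eq)
      then have "(\<Sum>c<k. map u (?T ! j) ! c \<bullet> (A *v map u (?T ! j) ! c)) \<le> s"
        using bound[unfolded ky_fan_bound_def, THEN spec, of "map u (?T ! j)"] I by simp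
      moreover have "u a \<bullet> (A *v u a) = \<mu> (h a)" for a
        using u by (simp add: Au orthonormal_frame_def)
      ultimately show "0 \<le> s - (\<Sum>c<k. \<mu> (h (?T ! j ! c)))"
        using I by simp
    qed
  qed
qed

section \<open>Linear functionals on the orbit\<close>

text \<open>The map sending \<open>ws\<close> to \<open>bs\<close> is an isometry by Parseval's identity, and the transpose is its inverse.\<close>

lemma orthogonal_matrix_between_frames:
  fixes ws bs :: "(real^'n) list"
  assumes ws: "orthonormal ws" "length ws = CARD('n)" and bs: "orthonormal bs" "length bs = CARD('n)"
  obtains g :: "real^'n^'n" where "orthogonal_matrix g"
    and "\<And>i. i < CARD('n) \<Longrightarrow> transpose g *v bs ! i = ws ! i"
proof -
  define f where "f x = (\<Sum>i<CARD('n). (ws ! i \<bullet> x) *\<^sub>R bs ! i)" for x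
  have f: "linear f"
    by (rule linearI) (simp_all add: f_def inner_add_right scaleR_add_left sum.distrib scaleR_sum_right)
  have "f v \<bullet> f w = v \<bullet> w" for v w
  proof -
    have "bs ! i \<bullet> f w = ws ! i \<bullet> w" if "i < CARD('n)" for i
      using inner_sum_orthonormal[OF bs(1), of i "\<lambda>i. ws ! i \<bullet> w"] that bs by (simp add: f_def)
    then have "f v \<bullet> f w = (\<Sum>i<CARD('n). (ws ! i \<bullet> v) * (ws ! i \<bullet> w))"
      by (simp add: f_def[of v] inner_sum_left)
    then show ?thesis using parseval[OF ws(1)] ws(2) by simp
  qed
  then have g: "orthogonal_matrix (matrix f)"
    using f orthogonal_transformation_matrix[of f] by (simp add: orthogonal_transformation_def)
  show thesis
  proof (rule that[OF g])
    fix i assume i: "i < CARD('n)"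
    have "matrix f *v ws ! i = f (ws ! i)" using f by simp
    also have "\<dots> = (\<Sum>j<CARD('n). if j = i then bs ! j else 0)"
      unfolding f_def using i ws by (intro sum.cong) (auto simp: orthonormalD)
    finally have "matrix f *v ws ! i = bs ! i" using i by simp
    then have "transpose (matrix f) *v bs ! i = (transpose (matrix f) ** matrix f) *v ws ! i"
      by (metis matrix_vector_mul_assoc)
    then show "transpose (matrix f) *v bs ! i = ws ! i"
      using g by (simp add: orthogonal_matrix)
  qed
qed

lemma inner_conjugate:
  fixes M :: "real^'n^'n"
  shows "x \<bullet> ((g ** M ** transpose g) *v x) = (transpose g *v x) \<bullet> (M *v (transpose g *v x))"
proof -
  have "(g ** M ** transpose g) *v x = g *v (M *v (transpose g *v x))"
    by (simp only: matrix_vector_mul_assoc matrix_mul_assoc)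
  then show ?thesis
    by (metis dot_lmul_matrix transpose_matrix_vector)
qed

lemma compact_orthogonal_matrices: "compact {g :: real^'n^'n. orthogonal_matrix g}"
proof (rule compact_eq_bounded_closed[THEN iffD2], rule conjI)
  have "norm g \<le> real CARD('n)" if "orthogonal_matrix g" for g :: "real^'n^'n"
  proof -
    have "norm g \<le> (\<Sum>i\<in>UNIV. norm (g $ i))"
      unfolding norm_vec_def by (rule L2_set_le_sum) simp
    also have "\<dots> = (\<Sum>i\<in>(UNIV :: 'n set). 1)"
      using that unfolding orthogonal_matrix_orthonormal_rows by (simp add: Finite_Cartesian_Product.row_def vec_lambda_eta)
    finally show ?thesis by simp
  qed
  then show "bounded {g :: real^'n^'n. orthogonal_matrix g}" by (auto simp: bounded_iff)
  show "closed {g :: real^'n^'n. orthogonal_matrix g}"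
    unfolding orthogonal_matrix matrix_matrix_mult_def Finite_Cartesian_Product.transpose_def
    by (intro closed_Collect_eq continuous_intros)
qed

lemma compact_orbitope: "compact (orbitope M)"
proof -
  have "continuous_on S (\<lambda>g :: real^'n^'n. g ** M ** transpose g)" for M S
    unfolding matrix_matrix_mult_def Finite_Cartesian_Product.transpose_def
    by (intro continuous_intros)
  then have "compact ((\<lambda>g. g ** M ** transpose g) ` {g. orthogonal_matrix g})"
    by (intro compact_continuous_image compact_orthogonal_matrices)
  then show ?thesis
    unfolding orbitope_def by (simp add: compact_convex_hull setcompr_eq_image)
qed

lemma orbit_symmetric_trace:
  assumes "transpose M = (M :: real^'n^'n)" "orthogonal_matrix g"
  shows "transpose (g ** M ** transpose g) = g ** M ** transpose g"
    and "Determinants.trace (g ** M ** transpose g) = Determinants.trace M"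
proof -
  show "transpose (g ** M ** transpose g) = g ** M ** transpose g"
    by (simp add: matrix_transpose_mul assms matrix_mul_assoc)
  have "Determinants.trace (g ** M ** transpose g) = Determinants.trace (transpose g ** g ** M)"
    by (metis trace_mul_sym matrix_mul_assoc)
  then show "Determinants.trace (g ** M ** transpose g) = Determinants.trace M"
    using assms(2) by (simp add: orthogonal_matrix)
qed

text \<open>Conjugation by \<open>g\<close> moves the tuple \<open>vs\<close> to another orthonormal tuple, on which Ky Fan's inequality for
  \<open>M\<close> applies.\<close>

lemma ky_fan_bound_orbit:
  fixes M :: "real^'n^'n"
  assumes eb: "eigenbasis M ws \<mu>" and g: "orthogonal_matrix g" and k: "k \<le> CARD('n)"
  shows "ky_fan_bound k (g ** M ** transpose g) (\<Sum>i<k. \<mu> i)"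
  unfolding ky_fan_bound_def
proof (intro allI impI, elim conjE)
  fix vs :: "(real^'n) list" assume vs: "orthonormal vs" "length vs = k"
  have "(transpose g *v x) \<bullet> (transpose g *v y) = x \<bullet> y" for x y
  proof -
    have "orthogonal_transformation ((*v) (transpose g))"
      using g by (simp only: orthogonal_transformation_matrix orthogonal_matrix_transpose
          matrix_of_matrix_vector_mul matrix_vector_mul_linear)
    then show ?thesis unfolding orthogonal_transformation_def by blast
  qed
  then have "orthonormal (map ((*v) (transpose g)) vs)"
    using vs(1) by (simp only: orthonormal_def length_map nth_map) simp
  from ky_fan[OF eb this] show "(\<Sum>c<k. vs ! c \<bullet> ((g ** M ** transpose g) *v vs ! c)) \<le> (\<Sum>i<k. \<mu> i)"
    using k vs by (simp only: inner_conjugate length_map nth_map) simp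
qed

lemma convex_ky_fan_bound: "convex {A. ky_fan_bound k A s}"
  unfolding ky_fan_bound_def
proof (rule convexI, simp only: mem_Collect_eq, intro allI impI, elim conjE)
  fix A B :: "real^'n^'n" and x y :: real and vs :: "(real^'n) list"
  assume A: "\<forall>vs. orthonormal vs \<and> length vs = k \<longrightarrow> (\<Sum>c<k. vs ! c \<bullet> (A *v vs ! c)) \<le> s"
    and B: "\<forall>vs. orthonormal vs \<and> length vs = k \<longrightarrow> (\<Sum>c<k. vs ! c \<bullet> (B *v vs ! c)) \<le> s"
    and xy: "0 \<le> x" "0 \<le> y" "x + y = 1" and vs: "orthonormal vs" "length vs = k"
  have "(\<Sum>c<k. vs ! c \<bullet> ((x *\<^sub>R A + y *\<^sub>R B) *v vs ! c)) =
      x * (\<Sum>c<k. vs ! c \<bullet> (A *v vs ! c)) + y * (\<Sum>c<k. vs ! c \<bullet> (B *v vs ! c))"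
    by (simp add: matrix_vector_mult_add_rdistrib scaleR_matrix_vector_assoc[symmetric] inner_add_right
        sum.distrib sum_distrib_left)
  also have "\<dots> \<le> s"
    using A B vs xy by (intro convex_bound_le) auto
  finally show "(\<Sum>c<k. vs ! c \<bullet> ((x *\<^sub>R A + y *\<^sub>R B) *v vs ! c)) \<le> s" .
qed

lemma inner_transpose: "transpose A \<bullet> transpose B = A \<bullet> (B :: real^'n^'m)"
  by (simp add: inner_vec_def Finite_Cartesian_Product.transpose_def) (rule sum.swap)

text \<open>Summation by parts writes the sum as \<open>(\<Sum>k. (\<beta> (k - 1) - \<beta> k) * D k)\<close> with the nonnegative partial sums
  \<open>D k\<close> of \<open>d\<close>; the boundary term vanishes with the total. The induction proves the corresponding
  inequality for the initial segments.\<close>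

lemma abel_summation_nonneg:
  fixes \<beta> d :: "nat \<Rightarrow> real"
  assumes dec: "\<And>i j. i \<le> j \<Longrightarrow> j < n \<Longrightarrow> \<beta> j \<le> \<beta> i"
    and partial: "\<And>k. k < n \<Longrightarrow> 0 \<le> (\<Sum>i<k. d i)" and total: "(\<Sum>i<n. d i) = 0"
  shows "0 \<le> (\<Sum>i<n. \<beta> i * d i)"
proof -
  have "\<beta> m * (\<Sum>i<Suc m. d i) \<le> (\<Sum>i<Suc m. \<beta> i * d i)" if "m < n" for m
    using that
  proof (induction m)
    case (Suc m)
    have "\<beta> (Suc m) * (\<Sum>i<Suc m. d i) \<le> \<beta> m * (\<Sum>i<Suc m. d i)"
      using Suc.prems by (intro mult_right_mono dec partial) auto
    with Suc show ?case by (simp add: algebra_simps)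
  qed simp
  then show ?thesis
    using total by (cases n) (force, metis lessI mult_zero_right)
qed

text \<open>Let \<open>g\<close> rotate the eigenbasis of \<open>M\<close> to that of \<open>B\<close>, keeping the order of the eigenvalues, so that
  \<open>B \<bullet> (g M g\<^sup>T) = (\<Sum>i. \<beta> i * \<mu> i)\<close>. In the same basis \<open>B \<bullet> A = (\<Sum>i. \<beta> i * (b\<^sub>i \<bullet> A b\<^sub>i))\<close>. The Ky Fan
  bounds for the first \<open>k\<close> vectors \<open>b\<^sub>i\<close> compare the partial sums of \<open>b\<^sub>i \<bullet> A b\<^sub>i\<close> and \<open>\<mu> i\<close>, the trace
  condition makes the totals agree, and summation by parts against the decreasing \<open>\<beta>\<close> gives the
  inequality.\<close>

lemma orbit_maximises_linear_functional:
  fixes A B M :: "real^'n^'n"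
  assumes eb: "eigenbasis M ws \<mu>" and B: "transpose B = B"
    and trace: "Determinants.trace A = Determinants.trace M"
    and bound: "\<And>k. k \<in> {1..CARD('n) - 1} \<Longrightarrow> ky_fan_bound k A (\<Sum>i<k. \<mu> i)"
  obtains g where "orthogonal_matrix g" "B \<bullet> A \<le> B \<bullet> (g ** M ** transpose g)"
proof -
  obtain bs \<beta> where bs: "eigenbasis B bs \<beta>" using eigenbasis_exists[OF B] .
  note ws' = eigenbasisD[OF eb] and bs' = eigenbasisD[OF bs]
  obtain g where g: "orthogonal_matrix g"
    and gb: "\<And>i. i < CARD('n) \<Longrightarrow> transpose g *v bs ! i = ws ! i"
    using orthogonal_matrix_between_frames[OF ws'(1,2) bs'(1,2)] by blast
  define d where "d i = \<mu> i - bs ! i \<bullet> (A *v bs ! i)" for i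
  have Mw: "ws ! i \<bullet> (M *v ws ! i) = \<mu> i" if "i < CARD('n)" for i
    using that by (simp add: ws' orthonormalD)
  have "0 \<le> (\<Sum>i<CARD('n). \<beta> i * d i)"
  proof (rule abel_summation_nonneg)
    show "\<beta> j \<le> \<beta> i" if "i \<le> j" "j < CARD('n)" for i j using bs'(4) that .
    show "0 \<le> (\<Sum>i<k. d i)" if k: "k < CARD('n)" for k
    proof (cases "k = 0")
      case False
      have "orthonormal (take k bs)" using bs'(1) by (simp add: orthonormal_def)
      then have "(\<Sum>c<k. take k bs ! c \<bullet> (A *v take k bs ! c)) \<le> (\<Sum>i<k. \<mu> i)"
        using bound[of k, unfolded ky_fan_bound_def, THEN spec, of "take k bs"] False k bs'(2) by simp
      then show ?thesis by (simp add: d_def sum_subtractf)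
    qed simp
    show "(\<Sum>i<CARD('n). d i) = 0"
      using trace trace_orthonormal[OF bs'(1,2), of A] trace_orthonormal[OF ws'(1,2), of M] Mw
      by (simp add: d_def sum_subtractf)
  qed
  also have "(\<Sum>i<CARD('n). \<beta> i * d i) = (\<Sum>i<CARD('n). \<beta> i * \<mu> i) - B \<bullet> A"
    by (simp add: inner_eigenbasis[OF bs] d_def right_diff_distrib sum_subtractf)
  also have "(\<Sum>i<CARD('n). \<beta> i * \<mu> i) = B \<bullet> (g ** M ** transpose g)"
    unfolding inner_eigenbasis[OF bs] by (rule sum.cong) (simp_all only: inner_conjugate gb Mw lessThan_iff)
  finally show thesis using that g by simp
qed

section \<open>The orbitope\<close>

text \<open>The right-hand side is convex and contains the orbit. Conversely, a point of it outside the compact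
  convex orbitope would be strictly separated from it by a linear functional, contradicting the preceding
  lemma.\<close>

theorem orbitope_eq_ky_fan_bounds:
  fixes M :: "real^'n^'n"
  assumes sym: "transpose M = M" and eb: "eigenbasis M ws \<mu>"
  shows "orbitope M = {A. transpose A = A \<and> Determinants.trace A = Determinants.trace M \<and>
    (\<forall>k\<in>{1..CARD('n) - 1}. ky_fan_bound k A (\<Sum>i<k. \<mu> i))}" (is "_ = ?R")
proof
  have "?R = {A. transpose A = A} \<inter> {A. Determinants.trace A = Determinants.trace M} \<inter>
      (\<Inter>k\<in>{1..CARD('n) - 1}. {A. ky_fan_bound k A (\<Sum>i<k. \<mu> i)})" by auto
  moreover have "convex {A :: real^'n^'n. transpose A = A}"
    by (rule convexI) (simp add: Finite_Cartesian_Product.transpose_def Finite_Cartesian_Product.vec_eq_iff)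
  moreover have "convex {A :: real^'n^'n. Determinants.trace A = Determinants.trace M}"
    by (rule convexI) (simp add: Determinants.trace_def sum.distrib sum_distrib_left[symmetric]
        distrib_right[symmetric])
  ultimately have "convex ?R"
    by (simp only:) (intro convex_Int convex_INT convex_ky_fan_bound)
  then show "orbitope M \<subseteq> ?R"
    unfolding orbitope_def
    using orbit_symmetric_trace[OF sym] ky_fan_bound_orbit[OF eb] by (intro hull_minimal) auto
  show "?R \<subseteq> orbitope M"
  proof (rule subsetI, rule ccontr)
    fix A assume A: "A \<in> ?R" and "A \<notin> orbitope M"
    have "convex (orbitope M)" "closed (orbitope M)"
      by (simp add: orbitope_def) (simp add: compact_imp_closed compact_orbitope)
    then obtain a b where a: "a \<bullet> A < b" "\<And>X. X \<in> orbitope M \<Longrightarrow> b < a \<bullet> X"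
      using separating_hyperplane_closed_point \<open>A \<notin> orbitope M\<close> by metis
    \<comment> \<open>Symmetrizing only doubles the functional on symmetric matrices; the sign turns a strict
      minimum at \<open>A\<close> into a strict maximum.\<close>
    define B where "B = - (a + transpose a)"
    have B: "transpose B = B"
      by (simp add: B_def Finite_Cartesian_Product.transpose_def Finite_Cartesian_Product.vec_eq_iff)
    have BX: "B \<bullet> X = - 2 * (a \<bullet> X)" if "transpose X = X" for X
      using inner_transpose[of a X] that by (simp add: B_def inner_add_left inner_diff_left)
    obtain g where g: "orthogonal_matrix g" and le: "B \<bullet> A \<le> B \<bullet> (g ** M ** transpose g)"
      using orbit_maximises_linear_functional[OF eb B, of A] A by blast
    have "g ** M ** transpose g \<in> orbitope M"
      unfolding orbitope_def using g by (intro hull_inc) blast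
    then have "a \<bullet> A < a \<bullet> (g ** M ** transpose g)" using a by force
    then show False
      using le A BX orbit_symmetric_trace(1)[OF sym g] by simp
  qed
qed

text \<open>The function \<open>lam\<close> counts from 1 and the eigenbasis of \<open>M\<close> from 0, so the sum of the \<open>k\<close> largest
  eigenvalues is reindexed before the description by Ky Fan bounds is applied.\<close>

theorem theorem3p4:
  fixes M :: "real^'n::{finite,linorder}^'n::{finite,linorder}" and lam :: "nat \<Rightarrow> real"
  assumes "transpose M = M"
    and "ordered_eigenvalues M lam"
  shows "orbitope M =
    {A. transpose A = A \<and> Determinants.trace A = Determinants.trace M \<and>
        (\<forall>k\<in>{1..CARD('n) - 1}.
           pos_semidef ((\<Sum>i=1..k. lam i) \<cdot>\<^sub>m 1\<^sub>m (CARD('n) choose k) - additive_compound k A))}"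
proof -
  obtain ws \<mu> where eb: "eigenbasis M ws \<mu>" using eigenbasis_exists[OF assms(1)] .
  have "pos_semidef ((\<Sum>i=1..k. lam i) \<cdot>\<^sub>m 1\<^sub>m (CARD('n) choose k) - additive_compound k A)
      \<longleftrightarrow> ky_fan_bound k A (\<Sum>i<k. \<mu> i)"
    if "transpose A = A" and k: "k \<in> {1..CARD('n) - 1}" for A :: "real^'n::{finite,linorder}^'n::{finite,linorder}" and k
  proof -
    have "k \<le> CARD('n)" using k by (meson atLeastAtMost_iff diff_le_self le_trans)
    then have "(\<Sum>i=1..k. lam i) = (\<Sum>i<k. \<mu> i)"
      using ordered_eigenvalues_eigenbasis[OF assms(2) eb]
      by (simp add: sum.atLeast1_atMost_eq)
    then show ?thesis
      using pos_semidef_additive_compound_iff[OF that(1) \<open>k \<le> CARD('n)\<close>] by simp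
  qed
  then show ?thesis
    unfolding orbitope_eq_ky_fan_bounds[OF assms(1) eb] by blast
qed

end
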